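(* Let $s$ and $d$ be coprime positive integers. There is a bijection between the set $\mathcal{CS}_{(s,s+d,s+2d)}$ of $(s,s+d,s+2d)$-CSYDs and (a) $\mathcal{F}\left(\frac{s+d+1}{2},-\frac{d}{2} \,;\, \{U\},\{D\}\right)$ if $s$ is odd and $d$ is even; (b) $\mathcal{F}\left(\frac{s+d+2}{2},-\frac{d+1}{2} \,;\, \{U\},\{FD,DD,U\}\right)$ if both $s$ and $d$ are odd; (c) $\mathcal{F}\left(\frac{s+d+1}{2},-\frac{d+1}{2} \,;\, \{U\},\{UU,DD\}\right)$ if $s$ is even and $d$ is odd.
   Context: A strict partition $\lambda=(\lambda_1>\lambda_2>\cdots>\lambda_\ell)$ is a finite (possibly empty) strictly decreasing sequence of positive integers. The shifted Young diagram $S(\lambda)$ has boxes $(i,j)$ (row $i$, column $j$) with $1\le i\le\ell$ and $i\le j\le i+\lambda_i-1$. The shifted hook length of a box $(i,j)$ is the number of boxes consisting of the box itself, the boxes to its right in row $i$, the boxes below it in column $j$, and all boxes of row $j+1$ of $S(\lambda)$ (if that row exists). $\lambda$ is an $s$-CSYD ($s$-core shifted Young diagram) if no shifted hook length of $S(\lambda)$ is divisible by $s$. $\mathcal{CS}_{(s_1,s_2,s_3)}$ is the set of strict partitions that are $s_k$-CSYDs for all $k=1,2,3$ (the empty partition included). A free Motzkin path of type $(m,n)$ is a path from $(0,0)$ to $(m,n)$ consisting of steps $U=(1,1)$, $F=(1,0)$, $D=(1,-1)$. For sets $A,B$ of finite sequences of steps, $\mathcal{F}(m,n\,;\,A,B)$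 is the set of free Motzkin paths of type $(m,n)$ that do not start with any sequence in $A$ and do not end with any sequence in $B$. *)

theory Defs
  imports Main "HOL-Library.Sublist"
begin

text \<open>A strict partition is the list of its parts, so the \<open>i\<close>-th part
  (\<open>i \<ge> 1\<close>) is \<open>xs ! (i - 1)\<close>. Boxes \<open>(i, j)\<close> are numbered from 1.\<close>

definition strict_partition :: "nat list \<Rightarrow> bool" where
  "strict_partition xs \<longleftrightarrow> sorted_wrt (>) xs \<and> (\<forall>x \<in> set xs. 0 < x)"

definition shifted_diagram :: "nat list \<Rightarrow> (nat \<times> nat) set" where
  "shifted_diagram xs =
     {(i, j). 1 \<le> i \<and> i \<le> length xs \<and> i \<le> j \<and> j \<le> i + xs ! (i - 1) - 1}"

definition shifted_hook :: "nat list \<Rightarrow> nat \<times> nat \<Rightarrow> (nat \<times> nat) set" where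
  "shifted_hook xs = (\<lambda>(i, j). {(a, b) \<in> shifted_diagram xs.
     (a, b) = (i, j) \<or> (a = i \<and> j < b) \<or> (i < a \<and> b = j) \<or> a = j + 1})"

definition shifted_hook_length :: "nat list \<Rightarrow> nat \<times> nat \<Rightarrow> nat" where
  "shifted_hook_length xs p = card (shifted_hook xs p)"

definition CSYD :: "nat \<Rightarrow> nat list \<Rightarrow> bool" where
  "CSYD s xs \<longleftrightarrow> strict_partition xs \<and>
     (\<forall>p \<in> shifted_diagram xs. \<not> s dvd shifted_hook_length xs p)"

definition CS :: "nat \<Rightarrow> nat \<Rightarrow> nat \<Rightarrow> nat list set" where
  "CS s\<^sub>1 s\<^sub>2 s\<^sub>3 = {xs. CSYD s\<^sub>1 xs \<and> CSYD s\<^sub>2 xs \<and> CSYD s\<^sub>3 xs}"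

datatype step = U | F | D

fun displacement :: "step \<Rightarrow> int \<times> int" where
  "displacement U = (1, 1)"
| "displacement F = (1, 0)"
| "displacement D = (1, -1)"

text \<open>A path starting at the origin is identified with its sequence of steps.\<close>

definition free_motzkin_path :: "int \<Rightarrow> int \<Rightarrow> step list \<Rightarrow> bool" where
  "free_motzkin_path m n w \<longleftrightarrow>
     (\<Sum>p\<leftarrow>w. fst (displacement p)) = m \<and> (\<Sum>p\<leftarrow>w. snd (displacement p)) = n"

definition free_motzkin_paths ::
    "int \<Rightarrow> int \<Rightarrow> step list set \<Rightarrow> step list set \<Rightarrow> step list set" where
  "free_motzkin_paths m n A B =
     {w. free_motzkin_path m n w \<and> (\<forall>a \<in> A. \<not> prefix a w) \<and> (\<forall>b \<in> B. \<not> suffix b w)}"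

end

theory Submission
  imports Defs "HOL-Library.Equipollence"
begin

text \<open>
  The proof turns a strict partition into the graph of a function on the integers, half a period of
  which is a free Motzkin path.

  Let \<open>B\<close> consist of the parts of the partition and the negatives of all positive integers that are not
  parts. The shifted hook lengths of row \<open>i\<close> are the sums of \<open>\<lambda>\<^sub>i\<close> with later parts and the numbers up to
  \<open>\<lambda>\<^sub>i\<close> that are not differences of \<open>\<lambda>\<^sub>i\<close> and a later part (\<open>row_hook_lengths\<close>). Hence no hook length is
  divisible by \<open>t\<close> if and only if \<open>B\<close> is closed under subtracting \<open>t\<close>, with the exception that for even
  \<open>t\<close> the element \<open>t / 2\<close> need not be lowered, while \<open>3 t / 2\<close> must be missing
  (\<open>CSYD_iff_bar_closed\<close>).

  Put \<open>n = s + d\<close> and write integers as \<open>n h + d j\<close>. Subtracting \<open>s\<close>, \<open>s + d\<close> or \<open>s + 2 d\<close> lowers \<open>h\<close> by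
  one and changes \<open>j\<close> by \<open>1\<close>, \<open>0\<close> or \<open>- 1\<close>.
  Leaving the exceptional elements aside, closure under \<open>n\<close> says that \<open>B\<close> is the region
  \<open>h \<le> f j\<close> below the graph of a function (\<open>bij_betw_below\<close>), and closure under the other two numbers that
  neighbouring values of \<open>f\<close> differ by at most one. As \<open>(h, j)\<close> and \<open>(h - d, j + n)\<close> stand for the same
  integer, and as \<open>B\<close> contains exactly one of \<open>x\<close> and \<open>- x\<close> for \<open>x \<noteq> 0\<close>, we have
  \<open>f (j + n) = f j - d\<close>, \<open>f 0 = - 1\<close>, and \<open>f (- j) = - 1 - f j\<close> unless \<open>n\<close> divides \<open>j\<close>. Thus \<open>f\<close> is determined by
  its values for \<open>0 < j < n / 2\<close>, which are arbitrary (\<open>profile_exists\<close>, \<open>profile_eqI\<close>), and these are the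
  heights of the path.

  The boundary conditions come from the two mirror axes. At \<open>j = 0\<close>, small steps on both sides mean
  \<open>f 1 \<in> {-1, 0}\<close>: a path from height \<open>0\<close> that does not start with \<open>U\<close>. At \<open>j = n / 2\<close> the parities
  matter. If \<open>d\<close> is even, the step across the axis allows two values on its left
  (\<open>bar_closed_iff_even_difference\<close>). If \<open>s\<close> is even, the exceptional elements \<open>s / 2\<close> and
  \<open>(s + 2 d) / 2\<close> lie next to the axis and relax the step across it (\<open>bar_closed_iff_odd_difference\<close>). If \<open>s\<close> and \<open>d\<close> are
  odd, the axis is a column containing \<open>n / 2\<close> and \<open>- n / 2\<close>, and whether \<open>n / 2\<close> is a part is one more
  bit of information (\<open>bar_closed_flip_iff\<close>), recorded by the last steps of the path. In every case, one or two
  steps to a fixed end height express the condition at the axis as a restriction on how the path ends.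
\<close>

section \<open>Shifted hook lengths\<close>

lemma strict_partition_nth_gap:
  assumes "strict_partition xs" "k \<le> l" "l < length xs"
  shows "xs ! l + (l - k) \<le> xs ! k"
  using assms(2,3)
proof (induction l rule: dec_induct)
  case (step m)
  have "xs ! Suc m < xs ! m"
    using assms(1) step.prems by (auto simp: strict_partition_def intro: sorted_wrt_nth_less)
  with step show ?case by (simp add: Suc_diff_le)
qed simp

lemma strict_partition_nth_pos:
  "strict_partition xs \<Longrightarrow> k < length xs \<Longrightarrow> 0 < xs ! k"
  by (simp add: strict_partition_def)

lemma strict_partition_nth_less:
  "strict_partition xs \<Longrightarrow> k < l \<Longrightarrow> l < length xs \<Longrightarrow> xs ! l < xs ! k"
  using strict_partition_nth_gap[of xs k l] by simp

text \<open>If \<open>j\<close> is smaller than the number of parts, column \<open>j\<close> meets every row from \<open>Suc i\<close> down to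
  row \<open>j\<close>, and row \<open>j + 1\<close> exists. The leg then makes up exactly for the boxes of row \<open>Suc i\<close> to
  the left of column \<open>j\<close>, so the hook counts two full parts.\<close>

lemma hook_length_inner:
  assumes "strict_partition xs" "i < j" "j < length xs"
  shows "(Suc i, j) \<in> shifted_diagram xs"
    and "shifted_hook_length xs (Suc i, j) = xs ! i + xs ! j"
proof -
  have gap: "xs ! k + (k - i) \<le> xs ! i" if "i \<le> k" "k < length xs" for k
    using strict_partition_nth_gap[OF assms(1)] that by blast
  have pos: "0 < xs ! j" using strict_partition_nth_pos assms by blast
  have j: "j \<le> i + xs ! i" using gap[of j] assms by simp
  then show "(Suc i, j) \<in> shifted_diagram xs"
    using assms by (auto simp: shifted_diagram_def)
  have leg: "j \<le> a + xs ! (a - 1) - 1" if "Suc i < a" "a \<le> j" for a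
    using strict_partition_nth_gap[OF assms(1), of "a - 1" j] pos that assms by linarith
  \<comment> \<open>the box with its arm, the leg, and the extra row\<close>
  let ?A = "Pair (Suc i) ` {j..i + xs ! i}" and ?L = "(\<lambda>a. (a, j)) ` {Suc i<..j}"
    and ?R = "Pair (Suc j) ` {Suc j..j + xs ! j}"
  have "shifted_hook xs (Suc i, j) = ?A \<union> ?L \<union> ?R"
  proof (intro subset_antisym subsetI)
    fix p assume "p \<in> shifted_hook xs (Suc i, j)"
    then show "p \<in> ?A \<union> ?L \<union> ?R"
      using j by (cases p) (auto simp: shifted_hook_def shifted_diagram_def image_iff)
  next
    fix p assume "p \<in> ?A \<union> ?L \<union> ?R"
    then show "p \<in> shifted_hook xs (Suc i, j)"
      using assms leg j by (auto simp: shifted_hook_def shifted_diagram_def)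
  qed
  moreover have "card (?A \<union> ?L \<union> ?R) = card ?A + card ?L + card ?R"
    using assms by (subst card_Un_disjoint; (subst card_Un_disjoint)?) auto
  moreover have "card ?A = i + xs ! i + 1 - j" "card ?L = j - Suc i" "card ?R = xs ! j"
    by (subst card_image; simp add: inj_on_def)+
  ultimately show "shifted_hook_length xs (Suc i, j) = xs ! i + xs ! j"
    using j assms by (simp add: shifted_hook_length_def)
qed

text \<open>In the remaining columns there is no row \<open>j + 1\<close>, and the column reaches down through an initial
  segment of the rows below, because \<open>k + xs ! k\<close> is weakly decreasing in \<open>k\<close>.\<close>

lemma hook_length_outer:
  assumes "length xs \<le> j" "j \<le> i + xs ! i"
    and c: "i + c < length xs" "\<And>k. i < k \<Longrightarrow> k < length xs \<Longrightarrow> j \<le> k + xs ! k \<longleftrightarrow> k \<le> i + c"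
  shows "shifted_hook_length xs (Suc i, j) = i + xs ! i + 1 - j + c"
proof -
  let ?A = "Pair (Suc i) ` {j..i + xs ! i}" and ?L = "(\<lambda>k. (Suc k, j)) ` {i<..i + c}"
  have "shifted_hook xs (Suc i, j) = ?A \<union> ?L"
  proof (intro subset_antisym subsetI)
    fix p assume p: "p \<in> shifted_hook xs (Suc i, j)"
    obtain a b where ab: "p = (a, b)" by (cases p)
    have in_row: "1 \<le> a" "a \<le> length xs" "a \<le> b" "b \<le> a + xs ! (a - 1) - 1"
      using p ab by (auto simp: shifted_hook_def shifted_diagram_def)
    have "(a = Suc i \<and> j \<le> b) \<or> (Suc i < a \<and> b = j)"
      using p ab in_row assms by (auto simp: shifted_hook_def)
    then show "p \<in> ?A \<union> ?L"
    proof
      assume "a = Suc i \<and> j \<le> b"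
      then show ?thesis using in_row ab by auto
    next
      assume "Suc i < a \<and> b = j"
      moreover from this have "i < a - 1" "a - 1 < length xs" "j \<le> a - 1 + xs ! (a - 1)"
        using in_row by auto
      moreover from this have "a - 1 \<le> i + c"
        using c(2)[of "a - 1"] by blast
      ultimately have "p = (Suc (a - 1), j)" "a - 1 \<in> {i<..i + c}" using ab by auto
      then show ?thesis by blast
    qed
  next
    fix p assume "p \<in> ?A \<union> ?L"
    then show "p \<in> shifted_hook xs (Suc i, j)"
      using assms by (auto simp: shifted_hook_def shifted_diagram_def)
  qed
  moreover have "card (?A \<union> ?L) = card ?A + card ?L"
    by (subst card_Un_disjoint) auto
  moreover have "card ?A = i + xs ! i + 1 - j" "card ?L = c"
    by (subst card_image; simp add: inj_on_def)+
  ultimately show ?thesis by (simp add: shifted_hook_length_def)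
qed

lemma initial_segment_of_interval:
  fixes i l :: nat
  assumes "i < l" and "\<And>k k'. i < k \<Longrightarrow> k \<le> k' \<Longrightarrow> k' < l \<Longrightarrow> Q k' \<Longrightarrow> Q k"
  obtains c where "i + c < l" "\<And>k. i < k \<Longrightarrow> k < l \<Longrightarrow> Q k \<longleftrightarrow> k \<le> i + c"
proof -
  define p where "p = (LEAST k. i < k \<and> (l \<le> k \<or> \<not> Q k))"
  have p: "i < p \<and> (l \<le> p \<or> \<not> Q p)"
    unfolding p_def by (rule LeastI[of _ l]) (use assms(1) in simp)
  have "p \<le> l"
    unfolding p_def by (rule Least_le) (use assms(1) in simp)
  have least: "Q k" if "i < k" "k < p" for k
    using not_less_Least[OF that(2)[unfolded p_def]] that by auto
  show thesis
  proof (rule that[of "p - i - 1"])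
    fix k assume k: "i < k" "k < l"
    have "\<not> Q k" if "p \<le> k" using assms(2)[of p k] p k that by auto
    then show "Q k \<longleftrightarrow> k \<le> i + (p - i - 1)" using least[of k] k p by force
  qed (use p \<open>p \<le> l\<close> in auto)
qed

text \<open>The inner columns give the sums of the row with the later parts. For an outer column, write the
  hook length as \<open>xs ! i - \<mu>\<close>: the column \<open>j\<close> is determined by the number \<open>c\<close> of later parts exceeding
  \<open>\<mu>\<close> through \<open>j = i + c + \<mu> + 1\<close>, and this works precisely when \<open>\<mu>\<close> is not itself a part.\<close>

lemma row_hook_lengths:
  assumes "strict_partition xs" "i < length xs"
  shows "(\<lambda>j. shifted_hook_length xs (Suc i, j)) ` {j. (Suc i, j) \<in> shifted_diagram xs} =
    {xs ! i + xs ! k |k. i < k \<and> k < length xs} \<union>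
    {v. 0 < v \<and> v \<le> xs ! i \<and> (\<forall>y \<in> set xs. v + y \<noteq> xs ! i)}" (is "?H ` ?J = ?S \<union> ?V")
proof (intro subset_antisym subsetI)
  let ?n = "length xs"
  note gap = strict_partition_nth_gap[OF assms(1)]
  fix v assume "v \<in> ?H ` ?J"
  then obtain j where "(Suc i, j) \<in> shifted_diagram xs" "v = ?H j"
    by blast
  then have j: "i < j" "j \<le> i + xs ! i" "v = ?H j"
    by (auto simp: shifted_diagram_def)
  show "v \<in> ?S \<union> ?V"
  proof (cases "j < ?n")
    case True
    then show ?thesis using hook_length_inner(2)[OF assms(1) j(1)] j by auto
  next
    case False
    have "j \<le> k + xs ! k" if "k \<le> k'" "k' < ?n" "j \<le> k' + xs ! k'" for k k'
      using gap[of k k'] that by linarith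
    then obtain c where c: "i + c < ?n"
        "\<And>k. i < k \<Longrightarrow> k < ?n \<Longrightarrow> j \<le> k + xs ! k \<longleftrightarrow> k \<le> i + c"
      using initial_segment_of_interval[OF assms(2), of "\<lambda>k. j \<le> k + xs ! k"] by metis
    have v: "v = i + xs ! i + 1 - j + c"
      using hook_length_outer False j c by simp
    have "v + xs ! k \<noteq> xs ! i" if "k < ?n" for k
    proof (cases "i < k")
      case True
      show ?thesis
      proof
        assume "v + xs ! k = xs ! i"
        then have "i + 1 + c + xs ! k = j" using v j by linarith
        moreover have "j \<le> k + xs ! k \<longleftrightarrow> k \<le> i + c" using c True that by blast
        ultimately show False by linarith
      qed
    next
      case False
      then show ?thesis using gap[of k i] assms v j by linarith
    qed
    then have "\<forall>y \<in> set xs. v + y \<noteq> xs ! i" by (auto simp: in_set_conv_nth)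
    then show ?thesis using v j c False by auto
  qed
next
  let ?n = "length xs"
  note gap = strict_partition_nth_gap[OF assms(1)] and pos = strict_partition_nth_pos[OF assms(1)]
  fix v assume "v \<in> ?S \<union> ?V"
  then show "v \<in> ?H ` ?J"
  proof
    assume "v \<in> ?S"
    then show ?thesis using hook_length_inner[OF assms(1)] by force
  next
    assume v: "v \<in> ?V"
    define \<mu> where "\<mu> = xs ! i - v"
    have \<mu>: "\<mu> < xs ! i" "v = xs ! i - \<mu>" using v by (auto simp: \<mu>_def)
    have ne: "xs ! k \<noteq> \<mu>" if "k < ?n" for k
      using v nth_mem[OF that] by (auto simp: \<mu>_def)
    have "\<mu> < xs ! k" if "k \<le> k'" "k' < ?n" "\<mu> < xs ! k'" for k k'
      using gap[of k k'] that by linarith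
    then obtain c where c: "i + c < ?n" "\<And>k. i < k \<Longrightarrow> k < ?n \<Longrightarrow> \<mu> < xs ! k \<longleftrightarrow> k \<le> i + c"
      using initial_segment_of_interval[OF assms(2), of "\<lambda>k. \<mu> < xs ! k"] by metis
    define j where "j = i + c + \<mu> + 1"
    have top: "\<mu> < xs ! (i + c)" using c \<mu> by (cases "c = 0") auto
    have j_le: "j \<le> i + xs ! i" using gap[of i "i + c"] c top by (simp add: j_def)
    have j_ge: "?n \<le> j"
    proof (cases "i + c + 1 = ?n")
      case False
      have "xs ! (i + c + 1) < \<mu>" using c(1) c(2)[of "i + c + 1"] ne[of "i + c + 1"] False by force
      moreover have "xs ! (?n - 1) + (?n - 1 - (i + c + 1)) \<le> xs ! (i + c + 1)" "0 < xs ! (?n - 1)"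
        using gap[of "i + c + 1" "?n - 1"] pos[of "?n - 1"] c(1) False by auto
      ultimately show ?thesis unfolding j_def by linarith
    qed (simp add: j_def)
    have "?H j = i + xs ! i + 1 - j + c"
    proof (rule hook_length_outer[OF j_ge j_le c(1)])
      fix k assume k: "i < k" "k < ?n"
      show "j \<le> k + xs ! k \<longleftrightarrow> k \<le> i + c"
      proof
        assume "k \<le> i + c"
        then show "j \<le> k + xs ! k" using gap[of k "i + c"] c top by (simp add: j_def)
      next
        assume *: "j \<le> k + xs ! k"
        show "k \<le> i + c"
        proof (rule ccontr)
          assume k': "\<not> k \<le> i + c"
          then have "xs ! (i + c + 1) < \<mu>"
            using c(2)[of "i + c + 1"] ne[of "i + c + 1"] k by force
          then show False using gap[of "i + c + 1" k] k k' * by (simp add: j_def)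
        qed
      qed
    qed
    then have "?H j = v" using \<mu> j_le by (simp add: j_def)
    moreover have "j \<in> ?J" using j_le j_ge assms by (auto simp: shifted_diagram_def j_def)
    ultimately show ?thesis by blast
  qed
qed

text \<open>The diagram disappears here: divisibility of hook lengths becomes a condition on the set of parts,
  taken from the description of the hook lengths in each row.\<close>

lemma CSYD_iff_parts:
  "CSYD t xs \<longleftrightarrow> strict_partition xs \<and>
     (\<forall>x \<in> set xs. \<forall>y \<in> set xs. x \<noteq> y \<longrightarrow> \<not> t dvd x + y) \<and>
     (\<forall>x \<in> set xs. \<forall>v. 0 < v \<and> v \<le> x \<and> t dvd v \<longrightarrow> x - v \<in> set xs)"
proof (cases "strict_partition xs")
  case strict: True
  let ?R = "\<lambda>i. {xs ! i + xs ! k |k. i < k \<and> k < length xs} \<union>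
    {v. 0 < v \<and> v \<le> xs ! i \<and> (\<forall>y \<in> set xs. v + y \<noteq> xs ! i)}"
  have rows: "?R i = (\<lambda>j. shifted_hook_length xs (Suc i, j)) ` {j. (Suc i, j) \<in> shifted_diagram xs}"
    if "i < length xs" for i
    using row_hook_lengths[OF strict that] by simp
  have "(\<forall>p \<in> shifted_diagram xs. \<not> t dvd shifted_hook_length xs p) \<longleftrightarrow>
      (\<forall>i < length xs. \<forall>v \<in> ?R i. \<not> t dvd v)" (is "?C \<longleftrightarrow> _")
  proof
    assume ?C
    then show "\<forall>i < length xs. \<forall>v \<in> ?R i. \<not> t dvd v" using rows by auto
  next
    assume *: "\<forall>i < length xs. \<forall>v \<in> ?R i. \<not> t dvd v"
    show ?C
    proof
      fix p assume p: "p \<in> shifted_diagram xs"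
      then obtain i j where "p = (Suc i, j)" "i < length xs"
        by (cases p, cases "fst p") (auto simp: shifted_diagram_def)
      then have "shifted_hook_length xs p \<in> ?R i" using p rows[of i] by blast
      then show "\<not> t dvd shifted_hook_length xs p" using * \<open>i < length xs\<close> by blast
    qed
  qed
  also have "\<dots> \<longleftrightarrow> (\<forall>i k. i < k \<and> k < length xs \<longrightarrow> \<not> t dvd xs ! i + xs ! k) \<and>
     (\<forall>x \<in> set xs. \<forall>v. 0 < v \<and> v \<le> x \<and> t dvd v \<longrightarrow> (\<exists>y \<in> set xs. v + y = x))"
    (is "_ \<longleftrightarrow> ?P1 \<and> ?P2")
  proof (intro iffI conjI)
    assume *: "\<forall>i < length xs. \<forall>v \<in> ?R i. \<not> t dvd v"
    show ?P1
    proof (intro allI impI)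
      fix i k assume "i < k \<and> k < length xs"
      then have "i < length xs" "xs ! i + xs ! k \<in> ?R i" by auto
      then show "\<not> t dvd xs ! i + xs ! k" using * by blast
    qed
    show ?P2
    proof (intro ballI allI impI)
      fix x v assume "x \<in> set xs" and v: "0 < v \<and> v \<le> x \<and> t dvd v"
      then obtain i where "i < length xs" "x = xs ! i" by (auto simp: in_set_conv_nth)
      then show "\<exists>y \<in> set xs. v + y = x" using * v by blast
    qed
  next
    assume *: "?P1 \<and> ?P2"
    show "\<forall>i < length xs. \<forall>v \<in> ?R i. \<not> t dvd v"
    proof (intro allI impI ballI)
      fix i v assume i: "i < length xs" and "v \<in> ?R i"
      then consider k where "i < k" "k < length xs" "v = xs ! i + xs ! k"
        | "0 < v" "v \<le> xs ! i" "\<forall>y \<in> set xs. v + y \<noteq> xs ! i" by blast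
      then show "\<not> t dvd v" using * nth_mem[OF i] by cases blast+
    qed
  qed
  also have "(\<forall>i k. i < k \<and> k < length xs \<longrightarrow> \<not> t dvd xs ! i + xs ! k) \<longleftrightarrow>
     (\<forall>x \<in> set xs. \<forall>y \<in> set xs. x \<noteq> y \<longrightarrow> \<not> t dvd x + y)" (is "?P \<longleftrightarrow> ?Q")
  proof
    assume P: ?P
    show ?Q
    proof (intro ballI impI)
      fix x y assume "x \<in> set xs" "y \<in> set xs" "x \<noteq> y"
      then obtain i k where "i < length xs" "k < length xs" "xs ! i = x" "xs ! k = y" "i \<noteq> k"
        by (auto simp: in_set_conv_nth)
      then show "\<not> t dvd x + y" using P by (metis add.commute nat_neq_iff)
    qed
  next
    assume ?Q
    then show ?P using strict_partition_nth_less[OF strict] by (metis less_trans nat_neq_iff nth_mem)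
  qed
  also have "(\<forall>x \<in> set xs. \<forall>v. 0 < v \<and> v \<le> x \<and> t dvd v \<longrightarrow> (\<exists>y \<in> set xs. v + y = x)) \<longleftrightarrow>
     (\<forall>x \<in> set xs. \<forall>v. 0 < v \<and> v \<le> x \<and> t dvd v \<longrightarrow> x - v \<in> set xs)"
    by (metis add_diff_cancel_left' le_add_diff_inverse)
  finally show ?thesis using strict by (simp add: CSYD_def)
qed (simp add: CSYD_def)

section \<open>Signed sets of parts\<close>

text \<open>The negatives of the missing parts make the two conditions on parts (differences stay parts, sums
  avoid multiples) one closure condition. Up to a shift by one half this is the beta set of the
  doubled distinct partition.\<close>

definition signed_set :: "nat list \<Rightarrow> int set" where
  "signed_set xs = int ` set xs \<union> {- int k |k. 0 < k \<and> k \<notin> set xs}"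

definition balanced :: "int set \<Rightarrow> bool" where
  "balanced B \<longleftrightarrow> 0 \<notin> B \<and> (\<forall>x. x \<noteq> 0 \<longrightarrow> (x \<in> B \<longleftrightarrow> - x \<notin> B)) \<and> (\<exists>N. \<forall>x \<in> B. x \<le> N)"

text \<open>For even \<open>t\<close>, the number \<open>t div 2\<close> may be a part although \<open>t div 2 - t\<close> is then missing, since a part is
  not added to itself; but then \<open>3 * (t div 2)\<close> is not a part, its sum with \<open>t div 2\<close> being \<open>2 * t\<close>.\<close>

definition bar_closed :: "int \<Rightarrow> int set \<Rightarrow> bool" where
  "bar_closed t B \<longleftrightarrow> (\<forall>x \<in> B. 2 * x \<noteq> t \<longrightarrow> x - t \<in> B) \<and> (\<forall>x \<in> B. 2 * x \<noteq> 3 * t)"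

lemma balanced_zero: "balanced B \<Longrightarrow> 0 \<notin> B"
  by (simp add: balanced_def)

lemma balanced_neg: "balanced B \<Longrightarrow> x \<noteq> 0 \<Longrightarrow> x \<in> B \<longleftrightarrow> - x \<notin> B"
  unfolding balanced_def by blast

lemma balanced_bounded: "balanced B \<Longrightarrow> \<exists>N. \<forall>x \<in> B. x \<le> N"
  by (simp add: balanced_def)

lemma int_in_signed_set: "int k \<in> signed_set xs \<longleftrightarrow> k \<in> set xs"
  by (auto simp: signed_set_def)

lemma neg_int_in_signed_set: "0 < k \<Longrightarrow> - int k \<in> signed_set xs \<longleftrightarrow> k \<notin> set xs"
  by (auto simp: signed_set_def)

lemma nonzero_int_cases:
  assumes "(x :: int) \<noteq> 0"
  obtains k where "0 < k" "x = int k \<or> x = - int k"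
  using assms that[of "nat \<bar>x\<bar>"] by fastforce

lemma balanced_signed_set:
  assumes "strict_partition xs"
  shows "balanced (signed_set xs)"
  unfolding balanced_def
proof (intro conjI allI impI)
  show "0 \<notin> signed_set xs"
    using assms int_in_signed_set[of 0 xs] by (auto simp: strict_partition_def)
  fix x :: int assume "x \<noteq> 0"
  then obtain k where "0 < k" "x = int k \<or> x = - int k"
    by (rule nonzero_int_cases)
  then show "x \<in> signed_set xs \<longleftrightarrow> - x \<notin> signed_set xs"
    using int_in_signed_set[of k xs] neg_int_in_signed_set[of k xs] by auto
next
  have "x \<le> int (sum_list xs)" if "x \<in> signed_set xs" for x
    using that member_le_sum_list[of _ xs] by (auto simp: signed_set_def)
  then show "\<exists>N. \<forall>x \<in> signed_set xs. x \<le> N" by blast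
qed

lemma bij_betw_signed_set:
  "bij_betw signed_set {xs. strict_partition xs} {B. balanced B}"
  unfolding bij_betw_def
proof (intro conjI subset_antisym subsetI)
  show "inj_on signed_set {xs. strict_partition xs}"
  proof (rule inj_onI)
    fix xs ys assume strict: "xs \<in> {xs. strict_partition xs}" "ys \<in> {xs. strict_partition xs}"
      and eq: "signed_set xs = signed_set ys"
    have "set xs = set ys" using eq int_in_signed_set by blast
    moreover have "sorted_wrt (<) (rev xs)" "sorted_wrt (<) (rev ys)"
      using strict by (simp_all add: strict_partition_def sorted_wrt_rev)
    ultimately have "rev xs = rev ys" by (intro strict_sorted_equal) auto
    then show "xs = ys" by simp
  qed
next
  fix B assume "B \<in> signed_set ` {xs. strict_partition xs}"
  then show "B \<in> {B. balanced B}" using balanced_signed_set by blast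
next
  fix B assume "B \<in> {B. balanced B}"
  then have B: "balanced B" by simp
  define P where "P = {k. 0 < k \<and> int k \<in> B}"
  obtain N where "\<forall>x \<in> B. x \<le> N" using B by (auto simp: balanced_def)
  then have "P \<subseteq> {..nat N}" by (force simp: P_def)
  then have fin: "finite P" by (rule finite_subset) simp
  define xs where "xs = rev (sorted_list_of_set P)"
  have set_xs: "set xs = P" using fin by (simp add: xs_def)
  have "sorted_wrt (>) xs"
    unfolding xs_def sorted_wrt_rev by (simp add: strict_sorted_list_of_set)
  then have "strict_partition xs" using set_xs by (auto simp: strict_partition_def P_def)
  moreover have "signed_set xs = B"
  proof (intro set_eqI)
    fix x :: int
    show "x \<in> signed_set xs \<longleftrightarrow> x \<in> B"
    proof (cases "x = 0")
      case True
      then show ?thesis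
        using B balanced_signed_set[OF \<open>strict_partition xs\<close>] by (simp add: balanced_def)
    next
      case False
      then obtain k where k: "0 < k" "x = int k \<or> x = - int k"
        by (rule nonzero_int_cases)
      have "int k \<noteq> 0" using k by simp
      then have "int k \<in> B \<longleftrightarrow> - int k \<notin> B" using B unfolding balanced_def by blast
      moreover have "k \<in> set xs \<longleftrightarrow> int k \<in> B" using k(1) set_xs by (simp add: P_def)
      ultimately show ?thesis
        using int_in_signed_set[of k xs] neg_int_in_signed_set[of k xs] k by blast
    qed
  qed
  ultimately show "B \<in> signed_set ` {xs. strict_partition xs}" by blast
qed

text \<open>Repeated subtraction of \<open>t\<close> cannot run into the exceptional element, because it would have to pass
  through \<open>3 * t / 2\<close> first.\<close>

lemma bar_closed_iterate:
  assumes "bar_closed t B" "x \<in> B" "2 * x \<noteq> t"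
  shows "x - int k * t \<in> B"
proof -
  have "x - int k * t \<in> B \<and> 2 * (x - int k * t) \<noteq> t"
  proof (induction k)
    case (Suc k)
    have *: "x - int (Suc k) * t = (x - int k * t) - t" by (simp add: algebra_simps)
    have "2 * (x - int k * t) \<noteq> 3 * t" using assms(1) Suc by (auto simp: bar_closed_def)
    then show ?case using assms(1) Suc unfolding * by (auto simp: bar_closed_def)
  qed (use assms in simp)
  then show ?thesis by blast
qed

text \<open>For a part \<open>x < t\<close> the element \<open>x - t\<close> is negative and says that \<open>t - x\<close> is not a part, which is the
  condition on sums. Conversely, a sum \<open>x + y = k * t\<close> of distinct parts would put \<open>- y\<close> into the signed
  set after \<open>k\<close> subtractions from whichever of the two is not \<open>t / 2\<close>.\<close>

lemma CSYD_iff_bar_closed: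
  assumes "strict_partition xs" "0 < t"
  shows "CSYD t xs \<longleftrightarrow> bar_closed (int t) (signed_set xs)"
proof -
  have pos: "0 \<notin> set xs" using assms(1) by (auto simp: strict_partition_def)
  show ?thesis
  proof
    assume "CSYD t xs"
    then have sums: "\<And>x y. x \<in> set xs \<Longrightarrow> y \<in> set xs \<Longrightarrow> x \<noteq> y \<Longrightarrow> \<not> t dvd x + y"
      and diffs: "\<And>x v. x \<in> set xs \<Longrightarrow> 0 < v \<Longrightarrow> v \<le> x \<Longrightarrow> t dvd v \<Longrightarrow> x - v \<in> set xs"
      by (auto simp: CSYD_iff_parts)
    show "bar_closed (int t) (signed_set xs)"
      unfolding bar_closed_def
    proof (intro conjI ballI impI)
      fix x assume "x \<in> signed_set xs" and ne: "2 * x \<noteq> int t"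
      then consider k where "x = int k" "k \<in> set xs" "t \<le> k"
        | k where "x = int k" "k \<in> set xs" "k < t"
        | k where "x = - int k" "0 < k" "k \<notin> set xs"
        unfolding signed_set_def by fastforce
      then show "x - int t \<in> signed_set xs"
      proof cases
        case 1
        then have "k - t \<in> set xs" using diffs assms(2) by simp
        then show ?thesis using 1 int_in_signed_set[of "k - t" xs] by (simp add: of_nat_diff)
      next
        case 2
        then have "k \<noteq> t - k" using ne by linarith
        then have "t - k \<notin> set xs" using sums[of k "t - k"] 2 by auto
        then show ?thesis
          using 2 neg_int_in_signed_set[of "t - k" xs] by (simp add: of_nat_diff)
      next
        case 3
        then have "k + t \<notin> set xs" using diffs[of "k + t" t] assms(2) by auto
        then show ?thesis using 3 neg_int_in_signed_set[of "k + t" xs] by simp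
      qed
    next
      fix x assume x: "x \<in> signed_set xs"
      show "2 * x \<noteq> 3 * int t"
      proof
        assume eq: "2 * x = 3 * int t"
        then obtain k where k: "x = int k" "k \<in> set xs"
          using x assms(2) by (auto simp: signed_set_def)
        then have *: "2 * k = 3 * t" using eq by linarith
        then have "k - t \<in> set xs" using diffs[of k t] k assms(2) by simp
        moreover have "k + (k - t) = t * 2" "k \<noteq> k - t" using * assms(2) by auto
        ultimately show False using sums[of k "k - t"] k(2) dvd_triv_left[of t 2] by simp
      qed
    qed
  next
    assume closed: "bar_closed (int t) (signed_set xs)"
    have no_sum: "\<not> t dvd x + y" if "x \<in> set xs" "y \<in> set xs" "2 * x \<noteq> t" for x y
    proof
      assume "t dvd x + y"
      then obtain k where "x + y = t * k" by blast
      then have eq: "int x + int y = int t * int k" by (metis of_nat_add of_nat_mult)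
      have "int x - int k * int t \<in> signed_set xs"
        by (rule bar_closed_iterate[OF closed]) (use that int_in_signed_set in auto)
      moreover have "int x - int k * int t = - int y" using eq by (simp add: algebra_simps)
      moreover have "0 < y" using that pos by (cases y) auto
      ultimately show False using neg_int_in_signed_set[of y xs] that by simp
    qed
    have "\<not> t dvd x + y" if "x \<in> set xs" "y \<in> set xs" "x \<noteq> y" for x y
      using no_sum[of x y] no_sum[of y x] that by (cases "2 * x = t") (auto simp: add.commute)
    moreover have "x - v \<in> set xs" if x: "x \<in> set xs" and v: "0 < v" "v \<le> x" "t dvd v" for x v
    proof -
      obtain k where k: "v = t * k" using v by blast
      have "t \<le> v" using v by (simp add: dvd_imp_le)
      then have "2 * int x \<noteq> int t" using v assms(2) by linarith
      then have "int x - int k * int t \<in> signed_set xs"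
        by (intro bar_closed_iterate[OF closed]) (use x int_in_signed_set in auto)
      moreover have "int x - int k * int t = int (x - v)"
        using v k by (simp add: of_nat_diff algebra_simps)
      ultimately show ?thesis using int_in_signed_set by metis
    qed
    ultimately show "CSYD t xs" using assms(1) by (simp add: CSYD_iff_parts)
  qed
qed

lemma bij_betw_CS:
  assumes "0 < t\<^sub>1" "0 < t\<^sub>2" "0 < t\<^sub>3"
  shows "bij_betw signed_set (CS t\<^sub>1 t\<^sub>2 t\<^sub>3)
    {B. balanced B \<and> bar_closed (int t\<^sub>1) B \<and> bar_closed (int t\<^sub>2) B \<and> bar_closed (int t\<^sub>3) B}"
proof -
  have "CS t\<^sub>1 t\<^sub>2 t\<^sub>3 = {xs \<in> {xs. strict_partition xs}. bar_closed (int t\<^sub>1) (signed_set xs) \<and>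
      bar_closed (int t\<^sub>2) (signed_set xs) \<and> bar_closed (int t\<^sub>3) (signed_set xs)}"
    using CSYD_iff_bar_closed assms by (auto simp: CS_def CSYD_def)
  then show ?thesis
    using bij_betw_Collect[OF bij_betw_signed_set] by simp
qed

section \<open>Profiles in lattice coordinates\<close>

lemma int_initial_segment:
  fixes S :: "int set"
  assumes "b \<in> S" "\<And>x. x \<in> S \<Longrightarrow> x \<le> N" "\<And>x. x \<in> S \<Longrightarrow> x - 1 \<in> S"
  shows "\<exists>t. \<forall>x. x \<in> S \<longleftrightarrow> x \<le> t"
proof -
  have "finite (S \<inter> {b..})" by (rule finite_subset[of _ "{b..N}"]) (use assms in auto)
  moreover have "b \<in> S \<inter> {b..}" using assms by simp
  ultimately have t: "Max (S \<inter> {b..}) \<in> S \<inter> {b..}"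
    and max: "\<And>x. x \<in> S \<Longrightarrow> b \<le> x \<Longrightarrow> x \<le> Max (S \<inter> {b..})"
    by (auto intro!: Max_in simp del: Int_iff) simp
  have "x \<in> S" if "y \<in> S" "x \<le> y" for x y
    using that(2,1) by (induction x rule: int_le_induct) (use assms(3) in auto)
  moreover have "x \<le> Max (S \<inter> {b..})" if "x \<in> S" for x
    using max[OF that] t by force
  ultimately show ?thesis using t by blast
qed

text \<open>Coprimality lets every integer be written as \<open>n * h + d * j\<close>, uniquely up to adding multiples of
  \<open>(- d, n)\<close> to \<open>(h, j)\<close>. Subtracting \<open>n - d\<close>, \<open>n\<close>, \<open>n + d\<close> lowers \<open>h\<close> by one and moves \<open>j\<close> by
  \<open>1\<close>, \<open>0\<close>, \<open>- 1\<close>.\<close>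

locale lattice_coordinates =
  fixes n d :: int
  assumes n_pos: "0 < n" and coprime: "coprime n d"
begin

text \<open>The three clauses express that the region below the graph is well defined as a set of integers and
  that it contains exactly one of \<open>x\<close> and \<open>- x\<close> for \<open>x \<noteq> 0\<close>. The column of the multiples of \<open>n\<close> is
  special because \<open>0\<close> is left out.\<close>

definition profile :: "(int \<Rightarrow> int) \<Rightarrow> bool" where
  "profile f \<longleftrightarrow> (\<forall>j. f (j + n) = f j - d) \<and> f 0 = -1 \<and>
     (\<forall>j. \<not> n dvd j \<longrightarrow> f (- j) = - 1 - f j)"

definition below :: "(int \<Rightarrow> int) \<Rightarrow> int set" where
  "below f = {n * h + d * j |h j. h \<le> f j}"

lemma same_column:
  assumes "n * h + d * j = n * h' + d * j'"
  obtains k where "j' = j + n * k" "h = h' + d * k"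
proof -
  have "d * (j' - j) = n * (h - h')" using assms by (simp add: algebra_simps)
  then have "n dvd d * (j' - j)" by simp
  then have "n dvd j' - j" using coprime by (simp add: coprime_dvd_mult_right_iff)
  then obtain k where k: "j' - j = n * k" by blast
  then have "n * (h - h') = n * (d * k)"
    using \<open>d * (j' - j) = n * (h - h')\<close> by (simp add: algebra_simps)
  then have "h - h' = d * k" using n_pos by simp
  then show thesis using that[of k] k by (simp add: algebra_simps)
qed

lemma every_int_in_lattice: obtains h j where "x = n * h + d * j"
proof -
  obtain u v where "u * n + v * d = 1"
    using bezout_int[of n d] coprime_imp_gcd_eq_1[OF coprime] by metis
  then have "x = x * (u * n + v * d)" by simp
  then have "x = n * (x * u) + d * (x * v)" by (simp add: algebra_simps)
  then show thesis using that by blast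
qed

lemma profile_shift:
  assumes "profile f"
  shows "f (j + n * k) = f j - d * k"
proof (induction k rule: int_induct[where k = 0])
  case (step1 i)
  have "f (j + n * i + n) = f (j + n * i) - d" using assms by (simp add: profile_def)
  then show ?case using step1 by (simp add: algebra_simps)
next
  case (step2 i)
  have "f (j + n * (i - 1) + n) = f (j + n * (i - 1)) - d" using assms unfolding profile_def by blast
  then show ?case using step2 by (simp add: algebra_simps)
qed simp

text \<open>Antisymmetry and periodicity combined: the columns on one side of \<open>n / 2\<close> determine the others.\<close>

lemma profile_reflect:
  assumes "profile f" "\<not> n dvd j"
  shows "f (n - j) = - 1 - d - f j"
proof -
  have "f (- j + n) = f (- j) - d" using assms(1) unfolding profile_def by blast
  moreover have "f (- j) = - 1 - f j" using assms unfolding profile_def by blast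
  ultimately show ?thesis by simp
qed

lemma mem_below:
  assumes "profile f"
  shows "n * h + d * j \<in> below f \<longleftrightarrow> h \<le> f j"
proof
  assume "n * h + d * j \<in> below f"
  then obtain h' j' where *: "n * h + d * j = n * h' + d * j'" "h' \<le> f j'"
    by (auto simp: below_def)
  then obtain k where "j' = j + n * k" "h = h' + d * k" using same_column by blast
  then show "h \<le> f j" using * profile_shift[OF assms, of j k] by simp
qed (auto simp: below_def)

lemma balanced_below:
  assumes "profile f"
  shows "balanced (below f)"
  unfolding balanced_def
proof (intro conjI allI impI)
  have f0: "f 0 = - 1" using assms by (simp add: profile_def)
  show "0 \<notin> below f" using mem_below[OF assms, of 0 0] f0 by simp
  fix x :: int assume "x \<noteq> 0"
  obtain h j where x: "x = n * h + d * j" using every_int_in_lattice .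
  have neg: "- x = n * (- h) + d * (- j)" using x by simp
  have "h \<le> f j \<longleftrightarrow> \<not> - h \<le> f (- j)"
  proof (cases "n dvd j")
    case True
    then obtain k where k: "j = n * k" by blast
    have "f j = - 1 - d * k" "f (- j) = - 1 + d * k"
      using profile_shift[OF assms, of 0 k] profile_shift[OF assms, of 0 "- k"] f0 k by auto
    moreover have "h \<noteq> - d * k" using \<open>x \<noteq> 0\<close> x k by auto
    ultimately show ?thesis by simp linarith
  next
    case False
    then have "f (- j) = - 1 - f j" using assms by (simp add: profile_def)
    then show ?thesis by linarith
  qed
  moreover have "x \<in> below f \<longleftrightarrow> h \<le> f j" using mem_below[OF assms, of h j] x by simp
  moreover have "- x \<in> below f \<longleftrightarrow> - h \<le> f (- j)"
    using mem_below[OF assms, of "- h" "- j"] neg by simp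
  ultimately show "x \<in> below f \<longleftrightarrow> - x \<notin> below f" by blast
next
  define N where "N = Max ((\<lambda>r. n * f r + d * r) ` {0..<n})"
  have "x \<le> N" if x: "x \<in> below f" for x
  proof -
    obtain h j where hj: "x = n * h + d * j" "h \<le> f j" using x by (auto simp: below_def)
    define r k where "r = j mod n" and "k = j div n"
    have j: "j = r + n * k" by (simp add: r_def k_def)
    then have "h + d * k \<le> f r" using hj profile_shift[OF assms, of r k] by simp
    then have "n * (h + d * k) \<le> n * f r" using n_pos by simp
    then have "x \<le> n * f r + d * r" using hj j by (simp add: algebra_simps)
    also have "\<dots> \<le> N" unfolding N_def by (rule Max_ge) (use n_pos in \<open>auto simp: r_def\<close>)
    finally show ?thesis .
  qed
  then show "\<exists>N. \<forall>x \<in> below f. x \<le> N" by blast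
qed

text \<open>A balanced set closed under subtracting \<open>n\<close> meets each column in an initial segment; it is nonempty and
  bounded since the set is bounded above and contains the negatives of all missing numbers. The top
  elements form the profile.\<close>

lemma bij_betw_below:
  "bij_betw below {f. profile f} {B. balanced B \<and> (\<forall>x \<in> B. x - n \<in> B)}"
  unfolding bij_betw_def
proof (intro conjI subset_antisym subsetI)
  show "inj_on below {f. profile f}"
  proof (rule inj_onI)
    fix f g assume "f \<in> {f. profile f}" "g \<in> {f. profile f}" "below f = below g"
    then have "h \<le> f j \<longleftrightarrow> h \<le> g j" for h j using mem_below by (metis mem_Collect_eq)
    then show "f = g" by (intro ext order_antisym) blast+
  qed
next
  fix B assume "B \<in> below ` {f. profile f}"
  then obtain f where f: "profile f" "B = below f" by blast
  have closed: "x - n \<in> below f" if x: "x \<in> below f" for x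
  proof -
    obtain h j where hj: "x = n * h + d * j" "h \<le> f j" using x by (auto simp: below_def)
    then have "x - n = n * (h - 1) + d * j" by (simp add: algebra_simps)
    moreover have "n * (h - 1) + d * j \<in> below f"
      using mem_below[OF f(1), of "h - 1" j] hj(2) by simp
    ultimately show ?thesis by simp
  qed
  then show "B \<in> {B. balanced B \<and> (\<forall>x \<in> B. x - n \<in> B)}"
    using balanced_below[OF f(1)] closed f(2) by simp
next
  fix B assume "B \<in> {B. balanced B \<and> (\<forall>x \<in> B. x - n \<in> B)}"
  then have B: "balanced B" and closed: "\<And>x. x \<in> B \<Longrightarrow> x - n \<in> B" by auto
  note zero = balanced_zero[OF B] and sym = balanced_neg[OF B]
  obtain N where N: "\<And>x. x \<in> B \<Longrightarrow> x \<le> N" using balanced_bounded[OF B] by blast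
  have "\<exists>t. \<forall>h. h \<in> {h. n * h + d * j \<in> B} \<longleftrightarrow> h \<le> t" for j
  proof (rule int_initial_segment)
    \<comment> \<open>so low that the value in column \<open>j\<close> is below \<open>- \<bar>N\<bar>\<close>; its negative exceeds \<open>N\<close> and is missing\<close>
    define b where "b = - (\<bar>N\<bar> + \<bar>d * j\<bar> + 1)"
    have "n * b \<le> 1 * b" by (rule mult_right_mono_neg) (use n_pos in \<open>auto simp: b_def\<close>)
    then have "n * b + d * j < - \<bar>N\<bar>" by (simp add: b_def)
    then have "n * b + d * j \<noteq> 0" "- (n * b + d * j) \<notin> B" using N[of "- (n * b + d * j)"] by auto
    then show "b \<in> {h. n * h + d * j \<in> B}" using sym by blast
  next
    fix h assume "h \<in> {h. n * h + d * j \<in> B}"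
    then have "n * h \<le> N - d * j" using N by force
    show "h \<le> \<bar>N - d * j\<bar>"
    proof (rule ccontr)
      assume "\<not> h \<le> \<bar>N - d * j\<bar>"
      moreover from this have "1 * h \<le> n * h" using n_pos by (intro mult_right_mono) auto
      ultimately show False using \<open>n * h \<le> N - d * j\<close> by linarith
    qed
  next
    fix h assume "h \<in> {h. n * h + d * j \<in> B}"
    then show "h - 1 \<in> {h. n * h + d * j \<in> B}"
      using closed[of "n * h + d * j"] by (simp add: algebra_simps)
  qed
  then have "\<forall>j. \<exists>t. \<forall>h. n * h + d * j \<in> B \<longleftrightarrow> h \<le> t" by simp
  then obtain f where f: "\<And>j h. n * h + d * j \<in> B \<longleftrightarrow> h \<le> f j" using choice by metis
  have "profile f"
    unfolding profile_def
  proof (intro conjI allI impI)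
    fix j
    have "h \<le> f (j + n) \<longleftrightarrow> h \<le> f j - d" for h
      using f[of h "j + n"] f[of "h + d" j] by (simp add: algebra_simps)
    then show "f (j + n) = f j - d" by (metis order_antisym order_refl)
  next
    have "n \<notin> B" using closed[of n] zero by auto
    then have "- n \<in> B" using sym[of n] n_pos by auto
    then show "f 0 = - 1" using f[of "- 1" 0] f[of 0 0] zero by simp
  next
    fix j assume j: "\<not> n dvd j"
    have "h \<le> f (- j) \<longleftrightarrow> h \<le> - 1 - f j" for h
    proof -
      have "n * h + d * (- j) \<noteq> 0"
      proof
        assume "n * h + d * (- j) = 0"
        then have "n * h + d * 0 = n * 0 + d * j" by simp
        then obtain k where "j = 0 + n * k" using same_column by blast
        then show False using j by simp
      qed
      then have "h \<le> f (- j) \<longleftrightarrow> \<not> - h \<le> f j"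
        using sym[of "n * h + d * (- j)"] f[of h "- j"] f[of "- h" j] by simp
      then show ?thesis by linarith
    qed
    then show "f (- j) = - 1 - f j" by (metis order_antisym order_refl)
  qed
  moreover have "below f = B"
  proof (intro set_eqI)
    fix x
    obtain h j where "x = n * h + d * j" using every_int_in_lattice .
    then show "x \<in> below f \<longleftrightarrow> x \<in> B" using mem_below[OF \<open>profile f\<close>] f by simp
  qed
  ultimately show "B \<in> below ` {f. profile f}" by blast
qed

lemma profile_eqI:
  assumes f: "profile f" and g: "profile g"
    and eq: "\<And>j. 1 \<le> j \<Longrightarrow> 2 * j < n \<Longrightarrow> f j = g j"
  shows "f = g"
proof
  fix j
  define r where "r = j mod n"
  have r: "0 \<le> r" "r < n" using n_pos by (auto simp: r_def)
  have "f r = g r"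
  proof (cases "r = 0")
    case True
    then show ?thesis using f g by (simp add: profile_def)
  next
    case False
    then have nd: "\<not> n dvd r" using r zdvd_not_zless by auto
    consider "2 * r < n" | "2 * r = n" | "2 * (n - r) < n"
      using less_linear[of "2 * r" n] by fastforce
    then show ?thesis
    proof cases
      case 1
      then show ?thesis using eq False r by simp
    next
      case 2
      then have "n - r = r" by simp
      then show ?thesis using profile_reflect[OF f nd] profile_reflect[OF g nd] by simp
    next
      case 3
      then have "f (n - r) = g (n - r)" using eq r by simp
      then show ?thesis using profile_reflect[OF f nd] profile_reflect[OF g nd] by simp
    qed
  qed
  moreover have "j = r + n * (j div n)" by (simp add: r_def)
  ultimately show "f j = g j" using profile_shift[OF f] profile_shift[OF g] by metis
qed

text \<open>The values in the columns strictly between \<open>0\<close> and \<open>n / 2\<close> are free. A column at \<open>n / 2\<close> is its own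
  mirror image, which forces its value to be \<open>- (d + 1) / 2\<close>; this is an integer because \<open>n\<close> is then even
  and \<open>d\<close> odd.\<close>

lemma profile_exists:
  obtains f where "profile f" "\<And>j. 1 \<le> j \<Longrightarrow> 2 * j < n \<Longrightarrow> f j = q j"
proof -
  define base where "base r = (if r = 0 then - 1 else if 2 * r < n then q r
    else if 2 * r = n then - ((d + 1) div 2) else - 1 - d - q (n - r))" for r
  define f where "f j = base (j mod n) - d * (j div n)" for j
  have base_reflect: "base (n - r) = - 1 - d - base r" if "0 < r" "r < n" for r
  proof (cases "2 * r = n")
    case True
    then have "n - r = r" "even n" by auto
    moreover from this have "odd d" using coprime coprime_common_divisor by fastforce
    ultimately show ?thesis using True that by (auto simp: base_def elim!: oddE)
  qed (use that in \<open>auto simp: base_def\<close>)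
  have "profile f"
    unfolding profile_def
  proof (intro conjI allI impI)
    fix j
    have "(j + n) div n = j div n + 1" using div_add_self2[of n j] n_pos by auto
    then show "f (j + n) = f j - d" by (simp add: f_def distrib_left)
  next
    show "f 0 = - 1" by (simp add: f_def base_def)
  next
    fix j assume j: "\<not> n dvd j"
    have "j mod n \<noteq> 0" using j by (simp add: dvd_eq_mod_eq_0)
    then have r: "0 < j mod n" "j mod n < n"
      using pos_mod_sign[OF n_pos, of j] pos_mod_bound[OF n_pos, of j] by linarith+
    have minus: "- j = n * (- (j div n) - 1) + (n - j mod n)"
      using mult_div_mod_eq[of n j] by (simp add: algebra_simps)
    have "(- j) div n = - (j div n) - 1" by (rule int_div_pos_eq[OF minus]) (use r in auto)
    moreover have "(- j) mod n = n - j mod n" by (rule int_mod_pos_eq[OF minus]) (use r in auto)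
    ultimately have "f (- j) = base (n - j mod n) - d * (- (j div n) - 1)" by (simp only: f_def)
    then show "f (- j) = - 1 - f j" using base_reflect[OF r] by (simp add: f_def right_diff_distrib)
  qed
  moreover have "f j = q j" if "1 \<le> j" "2 * j < n" for j
    using that by (simp add: f_def base_def)
  ultimately show thesis using that by blast
qed

section \<open>Closure under the two outer moduli\<close>

definition step_ok :: "(int \<Rightarrow> int) \<Rightarrow> int \<Rightarrow> bool" where
  "step_ok f j \<longleftrightarrow> \<bar>f (j + 1) - f j\<bar> \<le> 1"

text \<open>For odd \<open>n\<close> the excluded \<open>j\<close> are those for which the step from \<open>j\<close> to \<open>j + 1\<close> crosses the mirror
  axis at \<open>n / 2\<close> (modulo \<open>n\<close>); for even \<open>n\<close> nothing is excluded.\<close>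

definition outer_steps :: "(int \<Rightarrow> int) \<Rightarrow> bool" where
  "outer_steps f \<longleftrightarrow> (\<forall>j. \<not> n dvd 2 * j + 1 \<longrightarrow> step_ok f j)"

lemma step_ok_shift:
  assumes "profile f"
  shows "step_ok f (j + n * k) \<longleftrightarrow> step_ok f j"
proof -
  have "f (j + n * k + 1) = f (j + 1) - d * k"
    using profile_shift[OF assms, of "j + 1" k] by (simp add: algebra_simps)
  then show ?thesis
    using profile_shift[OF assms, of j k] unfolding step_ok_def by simp
qed

lemma step_ok_reflect:
  assumes "profile f" "\<not> n dvd j" "\<not> n dvd j + 1"
  shows "step_ok f (n - 1 - j) \<longleftrightarrow> step_ok f j"
proof -
  have "f (n - 1 - j) = - 1 - d - f (j + 1)"
    using profile_reflect[OF assms(1,3)] by (simp add: algebra_simps)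
  then show ?thesis
    using profile_reflect[OF assms(1,2)] unfolding step_ok_def by simp
qed

text \<open>The mirror image of a step is a step, so the steps on the left of the axis suffice. The steps on both
  sides of column \<open>0\<close>, where the value is \<open>- 1\<close>, read \<open>\<bar>f 1 + 1\<bar> \<le> 1\<close> and \<open>\<bar>f 1\<bar> \<le> 1\<close>.\<close>

lemma outer_steps_iff:
  assumes f: "profile f" and n: "2 \<le> n"
  shows "outer_steps f \<longleftrightarrow>
    f 1 \<in> {- 1, 0} \<and> (\<forall>j. 1 \<le> j \<and> 2 * j + 1 < n \<longrightarrow> step_ok f j)"
proof
  have f0: "f 0 = - 1" using f by (simp add: profile_def)
  have n1: "\<not> n dvd 1" using n by (simp add: zdvd_not_zless)
  then have fm1: "f (- 1) = - 1 - f 1" using f unfolding profile_def by blast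
  {
    assume outer: "outer_steps f"
    have "step_ok f 0" "step_ok f (- 1)" using outer n1 unfolding outer_steps_def by auto
    then have "f 1 \<in> {- 1, 0}" using f0 fm1 by (auto simp: step_ok_def)
    moreover have "step_ok f j" if "1 \<le> j" "2 * j + 1 < n" for j
      using outer that zdvd_not_zless[of "2 * j + 1" n] unfolding outer_steps_def by auto
    ultimately show "f 1 \<in> {- 1, 0} \<and> (\<forall>j. 1 \<le> j \<and> 2 * j + 1 < n \<longrightarrow> step_ok f j)" by blast
  next
    assume *: "f 1 \<in> {- 1, 0} \<and> (\<forall>j. 1 \<le> j \<and> 2 * j + 1 < n \<longrightarrow> step_ok f j)"
    have first: "step_ok f 0" "step_ok f (- 1)" using * f0 fm1 by (auto simp: step_ok_def)
    show "outer_steps f"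
      unfolding outer_steps_def
    proof (intro allI impI)
      fix j assume j: "\<not> n dvd 2 * j + 1"
      define r where "r = j mod n"
      have jr: "j = r + n * (j div n)" by (simp add: r_def)
      have r: "0 \<le> r" "r < n" using n by (auto simp: r_def)
      have eq: "2 * j + 1 = 2 * r + 1 + n * (2 * (j div n))" by (subst jr) (simp add: algebra_simps)
      have nr: "\<not> n dvd 2 * r + 1"
        using j unfolding eq by (simp only: dvd_add_left_iff dvd_triv_left) simp
      consider "r = 0" | "r = n - 1" | "1 \<le> r" "2 * r + 1 < n"
        | "1 \<le> r" "r \<le> n - 2" "n < 2 * r + 1"
        using nr r by (cases "2 * r + 1 = n") fastforce+
      then have "step_ok f r"
      proof cases
        case 2
        then show ?thesis using first(2) step_ok_shift[OF f, of "- 1" 1] by simp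
      next
        case 4
        have "step_ok f (n - 1 - r)" using * 4 by auto
        then show ?thesis using step_ok_reflect[OF f, of r] 4 by (simp add: zdvd_not_zless)
      qed (use * first in auto)
      then show "step_ok f j" using step_ok_shift[OF f, of r "j div n"] jr by simp
    qed
  }
qed

lemma diff_low: "n * h + d * j - (n - d) = n * (h - 1) + d * (j + 1)"
  and diff_high: "n * h + d * j - (n + d) = n * (h - 1) + d * (j - 1)"
  by (simp_all add: algebra_simps)

text \<open>The exceptional elements \<open>(n - d) / 2\<close> and \<open>(n + d) / 2\<close> lie in the two columns next to the axis, hence
  they affect only the step across it.\<close>

lemma double_eq_low: "2 * (n * h + d * j) = n - d \<Longrightarrow> n dvd 2 * j + 1"
proof -
  assume "2 * (n * h + d * j) = n - d"
  then have "d * (2 * j + 1) = n * (1 - 2 * h)" by (simp add: algebra_simps)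
  then have "n dvd d * (2 * j + 1)" by simp
  then show ?thesis using coprime by (simp add: coprime_dvd_mult_right_iff)
qed

lemma double_eq_high: "2 * (n * h + d * (j + 1)) = n + d \<Longrightarrow> n dvd 2 * j + 1"
proof -
  assume "2 * (n * h + d * (j + 1)) = n + d"
  then have "d * (2 * j + 1) = n * (1 - 2 * h)" by (simp add: algebra_simps)
  then have "n dvd d * (2 * j + 1)" by simp
  then show ?thesis using coprime by (simp add: coprime_dvd_mult_right_iff)
qed

text \<open>Closure under \<open>n - d\<close> bounds the descents of the profile and closure under \<open>n + d\<close> its ascents.\<close>

lemma bar_closed_low_step:
  assumes "profile f" "bar_closed (n - d) (below f)" "2 * (n * f j + d * j) \<noteq> n - d"
  shows "f j - 1 \<le> f (j + 1)"
proof -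
  have "n * f j + d * j \<in> below f" using mem_below[OF assms(1)] by simp
  then have "n * f j + d * j - (n - d) \<in> below f"
    using assms(2,3) unfolding bar_closed_def by blast
  then show ?thesis unfolding diff_low using mem_below[OF assms(1)] by blast
qed

lemma bar_closed_high_step:
  assumes "profile f" "bar_closed (n + d) (below f)" "2 * (n * f (j + 1) + d * (j + 1)) \<noteq> n + d"
  shows "f (j + 1) - 1 \<le> f j"
proof -
  have "n * f (j + 1) + d * (j + 1) \<in> below f" using mem_below[OF assms(1)] by simp
  then have "n * f (j + 1) + d * (j + 1) - (n + d) \<in> below f"
    using assms(2,3) unfolding bar_closed_def by blast
  then have "n * (f (j + 1) - 1) + d * (j + 1 - 1) \<in> below f" unfolding diff_high .
  then show ?thesis using mem_below[OF assms(1), of "f (j + 1) - 1" "j + 1 - 1"] by simp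
qed

lemma outer_steps_if_bar_closed:
  assumes "profile f" "bar_closed (n - d) (below f)" "bar_closed (n + d) (below f)"
  shows "outer_steps f"
  unfolding outer_steps_def step_ok_def
proof (intro allI impI)
  fix j assume j: "\<not> n dvd 2 * j + 1"
  have "f j - 1 \<le> f (j + 1)"
    using bar_closed_low_step[OF assms(1,2), of j] double_eq_low[of "f j" j] j by blast
  moreover have "f (j + 1) - 1 \<le> f j"
    using bar_closed_high_step[OF assms(1,3), of j] double_eq_high[of "f (j + 1)" j] j by blast
  ultimately show "\<bar>f (j + 1) - f j\<bar> \<le> 1" by linarith
qed

lemma bar_closed_lowI:
  assumes f: "profile f"
    and step: "\<And>h j. h \<le> f j \<Longrightarrow> 2 * (n * h + d * j) \<noteq> n - d \<Longrightarrow> h - 1 \<le> f (j + 1)"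
    and no: "\<And>x. x \<in> below f \<Longrightarrow> 2 * x \<noteq> 3 * (n - d)"
  shows "bar_closed (n - d) (below f)"
  unfolding bar_closed_def
proof (intro conjI ballI impI)
  fix x assume "x \<in> below f" "2 * x \<noteq> n - d"
  then obtain h j where "x = n * h + d * j" "h - 1 \<le> f (j + 1)"
    using step by (auto simp: below_def)
  then show "x - (n - d) \<in> below f"
    using mem_below[OF f, of "h - 1" "j + 1"] diff_low by metis
qed (use no in blast)

lemma bar_closed_highI:
  assumes f: "profile f"
    and step: "\<And>h j. h \<le> f (j + 1) \<Longrightarrow> 2 * (n * h + d * (j + 1)) \<noteq> n + d \<Longrightarrow> h - 1 \<le> f j"
    and no: "\<And>x. x \<in> below f \<Longrightarrow> 2 * x \<noteq> 3 * (n + d)"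
  shows "bar_closed (n + d) (below f)"
  unfolding bar_closed_def
proof (intro conjI ballI impI)
  fix x assume "x \<in> below f" and ne: "2 * x \<noteq> n + d"
  then obtain h j where hj: "x = n * h + d * j" "h \<le> f j" by (auto simp: below_def)
  then have "h - 1 \<le> f (j - 1)" using step[of h "j - 1"] ne by simp
  then have "n * (h - 1) + d * (j - 1) \<in> below f"
    using mem_below[OF f, of "h - 1" "j - 1"] by simp
  then show "x - (n + d) \<in> below f" using diff_high[of h j] hj by simp
qed (use no in blast)

lemma middle_column:
  assumes "n = 2 * m + 1"
  shows "n dvd 2 * j + 1 \<longleftrightarrow> (\<exists>k. j = m + n * k)"
proof
  assume "n dvd 2 * j + 1"
  moreover have "2 * j + 1 = 2 * (j - m) + n" using assms by simp
  ultimately have "n dvd 2 * (j - m)" by simp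
  moreover have "coprime n 2" using assms by simp
  ultimately have "n dvd j - m" using coprime_dvd_mult_right_iff[of n 2 "j - m"] by blast
  then obtain k where "j - m = n * k" by blast
  then have "j = m + n * k" by simp
  then show "\<exists>k. j = m + n * k" by blast
next
  assume "\<exists>k. j = m + n * k"
  then obtain k where "j = m + n * k" by blast
  then have "2 * j + 1 = n * (2 * k + 1)" using assms by (simp add: algebra_simps)
  then show "n dvd 2 * j + 1" by simp
qed

lemma profile_middle:
  assumes "profile f" "n = 2 * m + 1" "0 < m"
  shows "f (m + 1) = - 1 - d - f m"
proof -
  have "\<not> n dvd m" using assms by (simp add: zdvd_not_zless)
  moreover have "n - m = m + 1" using assms by simp
  ultimately show ?thesis using profile_reflect[OF assms(1), of m] by simp
qed

text \<open>All moduli are odd here, so there are no exceptional elements and every step must be small. The step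
  across the axis goes from \<open>f m\<close> to \<open>- 1 - d - f m\<close>.\<close>

lemma bar_closed_iff_even_difference:
  assumes f: "profile f" and m: "n = 2 * m + 1" "0 < m" and "even d"
  shows "bar_closed (n - d) (below f) \<and> bar_closed (n + d) (below f) \<longleftrightarrow>
    f 1 \<in> {- 1, 0} \<and> (\<forall>j. 1 \<le> j \<and> j < m \<longrightarrow> step_ok f j) \<and> f m \<in> {- (d div 2), - (d div 2) - 1}"
    (is "?C \<longleftrightarrow> ?R")
proof -
  have middle: "step_ok f m \<longleftrightarrow> f m \<in> {- (d div 2), - (d div 2) - 1}"
    using profile_middle[OF f m] \<open>even d\<close> by (auto simp: step_ok_def elim!: evenE)
  have "2 * x \<noteq> n - d" "2 * x \<noteq> n + d" "2 * x \<noteq> 3 * (n - d)" "2 * x \<noteq> 3 * (n + d)" for x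
    using m \<open>even d\<close> by presburger+
  note odd = this
  have "?C \<longleftrightarrow> (\<forall>j. step_ok f j)"
  proof
    assume C: ?C
    show "\<forall>j. step_ok f j"
    proof
      fix j
      have "f j - 1 \<le> f (j + 1)" using bar_closed_low_step[OF f] C odd by blast
      moreover have "f (j + 1) - 1 \<le> f j" using bar_closed_high_step[OF f] C odd by blast
      ultimately show "step_ok f j" by (simp add: step_ok_def)
    qed
  next
    assume steps: "\<forall>j. step_ok f j"
    show ?C
    proof
      show "bar_closed (n - d) (below f)"
      proof (rule bar_closed_lowI[OF f _ odd(3)])
        fix h j assume "h \<le> f j"
        moreover have "step_ok f j" using steps by blast
        ultimately show "h - 1 \<le> f (j + 1)" by (simp add: step_ok_def)
      qed
      show "bar_closed (n + d) (below f)"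
      proof (rule bar_closed_highI[OF f _ odd(4)])
        fix h j assume "h \<le> f (j + 1)"
        moreover have "step_ok f j" using steps by blast
        ultimately show "h - 1 \<le> f j" by (simp add: step_ok_def)
      qed
    qed
  qed
  also have "\<dots> \<longleftrightarrow> outer_steps f \<and> step_ok f m"
    using step_ok_shift[OF f] middle_column[OF m(1)] unfolding outer_steps_def by metis
  also have "\<dots> \<longleftrightarrow> ?R"
    using outer_steps_iff[OF f] m middle by auto
  finally show ?thesis .
qed

text \<open>Now \<open>n - d\<close> and \<open>n + d\<close> are even. Their halves have height \<open>1 - e\<close> in the columns \<open>m\<close> and
  \<open>m + 1\<close>, where \<open>f (m + 1) = - 2 * e - f m\<close>. As these elements need not be lowered, \<open>f m\<close> may differ from
  \<open>- e\<close> by one in either direction. The elements \<open>3 * (n - d) / 2\<close> and \<open>3 * (n + d) / 2\<close>, of height \<open>2 - e\<close> in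
  the columns \<open>m - 1\<close> and \<open>m + 2\<close>, must stay outside, which bounds \<open>f (m - 1)\<close> from above and, by
  reflection, from below.\<close>

lemma bar_closed_iff_odd_difference:
  assumes f: "profile f" and m: "n = 2 * m + 1" "0 < m" and d: "d = 2 * e - 1" "0 < d" "d < n"
  shows "bar_closed (n - d) (below f) \<and> bar_closed (n + d) (below f) \<longleftrightarrow>
    f 1 \<in> {- 1, 0} \<and> (\<forall>j. 1 \<le> j \<and> j < m \<longrightarrow> step_ok f j) \<and>
    \<bar>f m + e\<bar> \<le> 1 \<and> \<bar>f (m - 1) + e\<bar> \<le> 1" (is "?C \<longleftrightarrow> ?R")
proof -
  have m1: "f (m + 1) = - 2 * e - f m" using profile_middle[OF f m] d by simp
  \<comment> \<open>coordinates of the exceptional elements and of their triples\<close>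
  have low: "n - d = 2 * (n * (1 - e) + d * m)" "3 * (n - d) = 2 * (n * (2 - e) + d * (m - 1))"
    and high: "n + d = 2 * (n * (1 - e) + d * (m + 1))"
      "3 * (n + d) = 2 * (n * (2 - e) + d * (m + 2))"
    unfolding m(1) d(1) by (simp_all add: algebra_simps)
  have m2: "f (m + 2) \<le> 1 - e \<longleftrightarrow> - e - 1 \<le> f (m - 1)" and m3: "m = 1 \<Longrightarrow> \<bar>f (m - 1) + e\<bar> \<le> 1"
  proof -
    have f0: "f 0 = - 1" using f by (simp add: profile_def)
    show "m = 1 \<Longrightarrow> \<bar>f (m - 1) + e\<bar> \<le> 1" using f0 m d by auto
    show "f (m + 2) \<le> 1 - e \<longleftrightarrow> - e - 1 \<le> f (m - 1)"
    proof (cases "m = 1")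
      case True
      then have "f (m + 2) = f 0 - d" using profile_shift[OF f, of 0 1] m by simp
      then show ?thesis using True f0 d by auto
    next
      case False
      then have "\<not> n dvd m - 1" using m by (simp add: zdvd_not_zless)
      moreover have "n - (m - 1) = m + 2" using m by simp
      ultimately have "f (m + 2) = - 1 - d - f (m - 1)" using profile_reflect[OF f, of "m - 1"] by simp
      then show ?thesis using d by auto
    qed
  qed
  have outer: "outer_steps f \<longleftrightarrow> f 1 \<in> {- 1, 0} \<and> (\<forall>j. 1 \<le> j \<and> j < m \<longrightarrow> step_ok f j)"
    using outer_steps_iff[OF f] m by auto
  show ?thesis
  proof
    assume C: ?C
    have "f m \<le> 1 - e"
    proof (rule ccontr)
      assume *: "\<not> f m \<le> 1 - e"
      then have "2 * (n * f m + d * m) \<noteq> n - d" unfolding low(1) using n_pos by simp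
      then have "f m - 1 \<le> f (m + 1)" using bar_closed_low_step[OF f] C by blast
      then show False using * m1 by linarith
    qed
    moreover have "- e - 1 \<le> f m"
    proof (rule ccontr)
      assume *: "\<not> - e - 1 \<le> f m"
      then have "2 * (n * f (m + 1) + d * (m + 1)) \<noteq> n + d" unfolding high(1) using n_pos m1 by simp
      then have "f (m + 1) - 1 \<le> f m" using bar_closed_high_step[OF f] C by blast
      then show False using * m1 by linarith
    qed
    moreover have "f (m - 1) \<le> 1 - e"
    proof -
      have "n * (2 - e) + d * (m - 1) \<notin> below f"
        using C low(2) unfolding bar_closed_def by metis
      then show ?thesis using mem_below[OF f] by force
    qed
    moreover have "- e - 1 \<le> f (m - 1)"
    proof -
      have "n * (2 - e) + d * (m + 2) \<notin> below f"
        using C high(2) unfolding bar_closed_def by metis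
      then show ?thesis using mem_below[OF f] m2 by force
    qed
    ultimately show ?R
      using outer outer_steps_if_bar_closed[OF f] C by (simp add: abs_le_iff)
  next
    assume R: ?R
    then have steps: "outer_steps f" using outer by blast
    show ?C
    proof
      show "bar_closed (n - d) (below f)"
      proof (rule bar_closed_lowI[OF f])
        fix h j assume h: "h \<le> f j" and ne: "2 * (n * h + d * j) \<noteq> n - d"
        show "h - 1 \<le> f (j + 1)"
        proof (cases "n dvd 2 * j + 1")
          case True
          then obtain k where k: "j = m + n * k" using middle_column[OF m(1)] by blast
          have "n * h + d * j = n * (h + d * k) + d * m" unfolding k by (simp add: algebra_simps)
          then have "h + d * k \<noteq> 1 - e" using ne unfolding low(1) by auto
          moreover have "f j = f m - d * k" "f (j + 1) = f (m + 1) - d * k"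
            using profile_shift[OF f, of m k] profile_shift[OF f, of "m + 1" k] k
            by (simp_all add: algebra_simps)
          ultimately show ?thesis using R h m1 by linarith
        next
          case False
          then have "step_ok f j" using steps by (simp add: outer_steps_def)
          then show ?thesis using h by (simp add: step_ok_def)
        qed
      next
        fix x assume "x \<in> below f"
        moreover have "n * (2 - e) + d * (m - 1) \<notin> below f" using R mem_below[OF f] by auto
        ultimately have "x \<noteq> n * (2 - e) + d * (m - 1)" by blast
        then show "2 * x \<noteq> 3 * (n - d)" unfolding low(2) mult_cancel_left by simp
      qed
      show "bar_closed (n + d) (below f)"
      proof (rule bar_closed_highI[OF f])
        fix h j assume h: "h \<le> f (j + 1)" and ne: "2 * (n * h + d * (j + 1)) \<noteq> n + d"
        show "h - 1 \<le> f j"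
        proof (cases "n dvd 2 * j + 1")
          case True
          then obtain k where k: "j = m + n * k" using middle_column[OF m(1)] by blast
          have "n * h + d * (j + 1) = n * (h + d * k) + d * (m + 1)"
            unfolding k by (simp add: algebra_simps)
          then have "h + d * k \<noteq> 1 - e" using ne unfolding high(1) by auto
          moreover have "f j = f m - d * k" "f (j + 1) = f (m + 1) - d * k"
            using profile_shift[OF f, of m k] profile_shift[OF f, of "m + 1" k] k
            by (simp_all add: algebra_simps)
          ultimately show ?thesis using R h m1 by linarith
        next
          case False
          then have "step_ok f j" using steps by (simp add: outer_steps_def)
          then show ?thesis using h by (simp add: step_ok_def)
        qed
      next
        fix x assume "x \<in> below f"
        moreover have "n * (2 - e) + d * (m + 2) \<notin> below f" using R mem_below[OF f] m2 by auto
        ultimately have "x \<noteq> n * (2 - e) + d * (m + 2)" by blast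
        then show "2 * x \<noteq> 3 * (n + d)" unfolding high(2) mult_cancel_left by simp
      qed
    qed
  qed
qed

end

section \<open>The middle column of an even modulus\<close>

text \<open>If \<open>c\<close> is half of an even modulus, a balanced set that makes use of the exception contains \<open>c\<close> but
  not \<open>- c\<close>. Exchanging the two leads to a set closed under the modulus without exception.\<close>

definition flip :: "int \<Rightarrow> bool \<Rightarrow> int set \<Rightarrow> int set" where
  "flip c b B = (if b then insert c (B - {- c}) else B)"

lemma mem_flip_True: "x \<in> flip c True B \<longleftrightarrow> x = c \<or> (x \<in> B \<and> x \<noteq> - c)"
  by (auto simp: flip_def)

lemma half_not_mem:
  assumes "balanced B" "\<forall>x \<in> B. x - 2 * c \<in> B" "c \<noteq> 0"
  shows "c \<notin> B"
proof
  assume "c \<in> B"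
  then have "c - 2 * c \<in> B" using assms by blast
  then show False using balanced_neg[OF assms(1,3)] \<open>c \<in> B\<close> by simp
qed

lemma balanced_flip:
  assumes "balanced B" "c \<noteq> 0"
  shows "balanced (insert c (B - {- c}))"
  unfolding balanced_def
proof (intro conjI allI impI)
  show "0 \<notin> insert c (B - {- c})" using assms balanced_zero by auto
  fix x :: int assume "x \<noteq> 0"
  then show "x \<in> insert c (B - {- c}) \<longleftrightarrow> - x \<notin> insert c (B - {- c})"
    using balanced_neg[OF assms(1), of x] assms(2) by (cases "x = c"; cases "x = - c") auto
next
  obtain N where "\<forall>x \<in> B. x \<le> N" using balanced_bounded[OF assms(1)] by blast
  then show "\<exists>N. \<forall>x \<in> insert c (B - {- c}). x \<le> N" by (intro exI[of _ "max c N"]) auto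
qed

lemma bij_betw_flip:
  assumes "0 < c"
  shows "bij_betw (\<lambda>(B, b). flip c b B) ({B. balanced B \<and> (\<forall>x \<in> B. x - 2 * c \<in> B)} \<times> UNIV)
    {B. balanced B \<and> bar_closed (2 * c) B}"
proof (rule bij_betw_byWitness)
  let ?g = "\<lambda>B. (if c \<in> B then insert (- c) (B - {c}) else B, c \<in> B)"
  let ?S = "{B. balanced B \<and> (\<forall>x \<in> B. x - 2 * c \<in> B)}"
  show "\<forall>a \<in> ?S \<times> UNIV. ?g (case a of (B, b) \<Rightarrow> flip c b B) = a"
  proof
    fix a :: "int set \<times> bool" assume "a \<in> ?S \<times> UNIV"
    then obtain B b where a: "a = (B, b)" and B: "balanced B" "\<forall>x \<in> B. x - 2 * c \<in> B" by blast
    have "c \<notin> B" by (rule half_not_mem[OF B]) (use assms in simp)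
    moreover from this have "- c \<in> B" using balanced_neg[OF B(1), of c] assms by simp
    ultimately show "?g (case a of (B, b) \<Rightarrow> flip c b B) = a"
      unfolding a by (auto simp: flip_def)
  qed
  show "\<forall>B \<in> {B. balanced B \<and> bar_closed (2 * c) B}. (case ?g B of (B, b) \<Rightarrow> flip c b B) = B"
  proof
    fix B assume "B \<in> {B. balanced B \<and> bar_closed (2 * c) B}"
    then have B: "balanced B" by blast
    have "- c \<notin> B" if "c \<in> B" using balanced_neg[OF B, of c] assms that by simp
    then show "(case ?g B of (B, b) \<Rightarrow> flip c b B) = B" by (auto simp: flip_def)
  qed
  show "(\<lambda>(B, b). flip c b B) ` (?S \<times> UNIV) \<subseteq> {B. balanced B \<and> bar_closed (2 * c) B}"
  proof (rule image_subsetI)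
    fix a :: "int set \<times> bool" assume "a \<in> ?S \<times> UNIV"
    then obtain B b where a: "a = (B, b)" and B: "balanced B" "\<forall>x \<in> B. x - 2 * c \<in> B" by blast
    have c: "c \<notin> B" by (rule half_not_mem[OF B]) (use assms in simp)
    have c3: "3 * c \<notin> B" using B(2) c by force
    have "balanced (flip c b B)" using B(1) balanced_flip[OF B(1), of c] assms by (simp add: flip_def)
    moreover have "bar_closed (2 * c) (flip c b B)"
      unfolding bar_closed_def
    proof (intro conjI ballI impI)
      fix x assume "x \<in> flip c b B" "2 * x \<noteq> 2 * c"
      then have "x \<in> B" "x \<noteq> c" by (auto simp: flip_def split: if_splits)
      then have "x - 2 * c \<in> B" "x - 2 * c \<noteq> - c" using B by auto
      then show "x - 2 * c \<in> flip c b B" by (simp add: flip_def)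
    next
      fix x assume x: "x \<in> flip c b B"
      have "x \<noteq> 3 * c" using x c3 assms by (auto simp: flip_def split: if_splits)
      then show "2 * x \<noteq> 3 * (2 * c)" by simp
    qed
    ultimately show "(case a of (B, b) \<Rightarrow> flip c b B) \<in> {B. balanced B \<and> bar_closed (2 * c) B}"
      unfolding a by simp
  qed
  show "?g ` {B. balanced B \<and> bar_closed (2 * c) B} \<subseteq> ?S \<times> UNIV"
  proof (rule image_subsetI)
    fix B assume "B \<in> {B. balanced B \<and> bar_closed (2 * c) B}"
    then have B: "balanced B" "bar_closed (2 * c) B" by blast+
    have c3: "3 * c \<notin> B" using B(2) by (auto simp: bar_closed_def)
    then have "- 3 * c \<in> B" using balanced_neg[OF B(1), of "3 * c"] assms by simp
    have sub: "x - 2 * c \<in> B" "x - 2 * c \<noteq> c" if "x \<in> B" "x \<noteq> c" for x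
      using that B(2) c3 by (auto simp: bar_closed_def)
    have "(if c \<in> B then insert (- c) (B - {c}) else B) \<in> ?S"
    proof (cases "c \<in> B")
      case True
      have "balanced (insert (- c) (B - {c}))" using balanced_flip[OF B(1), of "- c"] assms by simp
      moreover have "x - 2 * c \<in> insert (- c) (B - {c})" if "x \<in> insert (- c) (B - {c})" for x
        using that sub \<open>- 3 * c \<in> B\<close> assms by auto
      ultimately show ?thesis using True by simp
    next
      case False
      then have "x - 2 * c \<in> B" if "x \<in> B" for x using sub that by auto
      then show ?thesis using False B by simp
    qed
    then show "?g B \<in> ?S \<times> UNIV" by blast
  qed
qed

context lattice_coordinates
begin

text \<open>The axis \<open>c = n / 2\<close> is now a column, whose profile value is \<open>- e\<close>; its elements of heights \<open>1 - e\<close>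
  and \<open>- e\<close> are \<open>c\<close> and \<open>- c\<close>. Once they are exchanged, \<open>c\<close> has to be lowered into both
  neighbouring columns while nothing may be lowered to \<open>- c\<close>, which leaves only the value \<open>- e\<close> in the
  neighbouring columns.\<close>

lemma bar_closed_flip_iff:
  assumes f: "profile f" and c: "n = 2 * c" and d: "d = 2 * e - 1" "0 < d" "d < n"
  shows "bar_closed (n - d) (flip c b (below f)) \<and> bar_closed (n + d) (flip c b (below f)) \<longleftrightarrow>
    f 1 \<in> {- 1, 0} \<and> (\<forall>j. 1 \<le> j \<and> j < c \<longrightarrow> step_ok f j) \<and>
    (b \<longrightarrow> f (c - 1) = - e \<and> f (c + 1) = - e)" (is "?C \<longleftrightarrow> ?R")
proof -
  have odd: "2 * x \<noteq> n - d" "2 * x \<noteq> n + d" "2 * x \<noteq> 3 * (n - d)" "2 * x \<noteq> 3 * (n + d)" for x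
    using c d(1) by presburger+
  have bar: "bar_closed (n - d) B \<longleftrightarrow> (\<forall>x \<in> B. x - (n - d) \<in> B)"
      "bar_closed (n + d) B \<longleftrightarrow> (\<forall>x \<in> B. x - (n + d) \<in> B)" for B
    using odd by (auto simp: bar_closed_def)
  have all_outer: "outer_steps f \<longleftrightarrow> (\<forall>j. step_ok f j)"
  proof -
    have "\<not> n dvd 2 * j + 1" for j using c by (metis dvd_mult_left even_plus_one_iff dvd_triv_left)
    then show ?thesis by (simp add: outer_steps_def)
  qed
  have outer: "outer_steps f \<longleftrightarrow> f 1 \<in> {- 1, 0} \<and> (\<forall>j. 1 \<le> j \<and> j < c \<longrightarrow> step_ok f j)"
    using outer_steps_iff[OF f] c n_pos by auto
  have closed_below: "bar_closed (n - d) (below f) \<and> bar_closed (n + d) (below f)"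
    if "\<forall>j. step_ok f j"
  proof
    have step: "f j - 1 \<le> f (j + 1)" "f (j + 1) - 1 \<le> f j" for j
    proof -
      have "step_ok f j" using that by blast
      then show "f j - 1 \<le> f (j + 1)" "f (j + 1) - 1 \<le> f j" by (auto simp: step_ok_def)
    qed
    show "bar_closed (n - d) (below f)"
    proof (rule bar_closed_lowI[OF f _ odd(3)])
      fix h j assume "h \<le> f j"
      then show "h - 1 \<le> f (j + 1)" using step(1)[of j] by linarith
    qed
    show "bar_closed (n + d) (below f)"
    proof (rule bar_closed_highI[OF f _ odd(4)])
      fix h j assume "h \<le> f (j + 1)"
      then show "h - 1 \<le> f j" using step(2)[of j] by linarith
    qed
  qed
  show ?thesis
  proof (cases b)
    case False
    then have eq: "flip c b (below f) = below f" by (simp add: flip_def)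
    have "?C \<longleftrightarrow> (\<forall>j. step_ok f j)"
      unfolding eq using closed_below outer_steps_if_bar_closed[OF f] all_outer by blast
    then show ?thesis using outer all_outer False by blast
  next
    case True
    let ?B = "flip c True (below f)"
    have fc: "f c = - e"
    proof -
      have "\<not> n dvd c" using c n_pos by (simp add: zdvd_not_zless)
      then show ?thesis using profile_reflect[OF f, of c] c d by simp
    qed
    have cc: "c = n * (1 - e) + d * c" "- c = n * (- e) + d * c"
      unfolding c d(1) by (simp_all add: algebra_simps)
    have shifts: "- c + (n - d) = n * (1 - e) + d * (c - 1)" "- c + (n + d) = n * (1 - e) + d * (c + 1)"
        "c - (n - d) = n * (- e) + d * (c + 1)" "c - (n + d) = n * (- e) + d * (c - 1)"
      unfolding c d(1) by (simp_all add: algebra_simps)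
    \<comment> \<open>exchanging \<open>c\<close> and \<open>- c\<close> changes only the middle column\<close>
    have column: "\<exists>k. j = c + n * k" if "n * h + d * j = c \<or> n * h + d * j = - c" for h j
      using that
    proof
      assume *: "n * h + d * j = c"
      have "n * (1 - e) + d * c = n * h + d * j" using * cc(1) by linarith
      then show ?thesis by (rule same_column) blast
    next
      assume *: "n * h + d * j = - c"
      have "n * (- e) + d * c = n * h + d * j" using * cc(2) by linarith
      then show ?thesis by (rule same_column) blast
    qed
    have C_iff: "?C \<longleftrightarrow> (\<forall>x \<in> ?B. x - (n - d) \<in> ?B) \<and> (\<forall>x \<in> ?B. x - (n + d) \<in> ?B)"
      using True by (simp only: bar)
    have "?C \<longleftrightarrow> (\<forall>j. step_ok f j) \<and> f (c - 1) = - e \<and> f (c + 1) = - e"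
    proof
      assume C: ?C
      have low: "x - (n - d) \<in> ?B" and high: "x - (n + d) \<in> ?B" if "x \<in> ?B" for x
        using C that unfolding C_iff by auto
      have mc: "- c \<notin> ?B" and pc: "c \<in> ?B" using c n_pos by (auto simp: mem_flip_True)
      have "- c + (n - d) \<notin> ?B" using low[of "- c + (n - d)"] mc by auto
      then have "- c + (n - d) \<notin> below f" using d by (simp add: mem_flip_True)
      then have up: "f (c - 1) < 1 - e" unfolding shifts using mem_below[OF f] by force
      have "- c + (n + d) \<notin> ?B" using high[of "- c + (n + d)"] mc by auto
      then have "- c + (n + d) \<notin> below f" using d n_pos by (simp add: mem_flip_True)
      then have up': "f (c + 1) < 1 - e" unfolding shifts using mem_below[OF f] by force
      have "c - (n - d) \<in> below f" using low[OF pc] d c by (simp add: mem_flip_True)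
      then have lo: "- e \<le> f (c + 1)" unfolding shifts using mem_below[OF f] by blast
      have "c - (n + d) \<in> below f" using high[OF pc] d n_pos by (simp add: mem_flip_True)
      then have lo': "- e \<le> f (c - 1)" unfolding shifts using mem_below[OF f] by blast
      have vals: "f (c - 1) = - e" "f (c + 1) = - e" using up up' lo lo' by auto
      have mid: "step_ok f c" "step_ok f (c - 1)" using vals fc by (auto simp: step_ok_def)
      have "step_ok f j" for j
      proof (cases "(\<exists>k. j = c + n * k) \<or> (\<exists>k. j + 1 = c + n * k)")
        case True
        then obtain k where "j = c + n * k \<or> j + 1 = c + n * k" by blast
        then have "j = c + n * k \<or> j = (c - 1) + n * k" by linarith
        then show ?thesis using mid step_ok_shift[OF f, of c k] step_ok_shift[OF f, of "c - 1" k] by metis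
      next
        case off: False
        have in_flip: "n * h + d * i \<in> ?B \<longleftrightarrow> h \<le> f i" if "\<nexists>k. i = c + n * k" for h i
          using column[of h i] that mem_below[OF f, of h i] by (auto simp: mem_flip_True)
        have "n * f j + d * j \<in> ?B" "n * f (j + 1) + d * (j + 1) \<in> ?B" using in_flip off by auto
        then have "n * (f j - 1) + d * (j + 1) \<in> ?B" "n * (f (j + 1) - 1) + d * (j + 1 - 1) \<in> ?B"
          using low high diff_low diff_high by metis+
        then have "f j - 1 \<le> f (j + 1)" "f (j + 1) - 1 \<le> f j"
          using in_flip[of "j + 1" "f j - 1"] in_flip[of j "f (j + 1) - 1"] off by auto
        then show ?thesis by (simp add: step_ok_def)
      qed
      then show "(\<forall>j. step_ok f j) \<and> f (c - 1) = - e \<and> f (c + 1) = - e" using vals by blast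
    next
      assume R: "(\<forall>j. step_ok f j) \<and> f (c - 1) = - e \<and> f (c + 1) = - e"
      have closed: "x - (n - d) \<in> below f" "x - (n + d) \<in> below f" if "x \<in> below f" for x
        using closed_below[unfolded bar] R that by auto
      have pc: "c - (n - d) \<in> below f" "c - (n + d) \<in> below f"
        unfolding shifts mem_below[OF f] using R by simp_all
      have mc: "- c + (n - d) \<notin> below f" "- c + (n + d) \<notin> below f"
        unfolding shifts mem_below[OF f] using R by simp_all
      have "x - (n - d) \<in> ?B \<and> x - (n + d) \<in> ?B" if "x \<in> ?B" for x
      proof (cases "x = c")
        case True
        have "c - (n - d) \<noteq> - c" "c - (n + d) \<noteq> - c" using c d by auto
        then show ?thesis using True pc by (simp add: mem_flip_True)
      next
        case False
        then have x: "x \<in> below f" using that by (simp add: mem_flip_True)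
        then have "x \<noteq> - c + (n - d)" "x \<noteq> - c + (n + d)" using mc by auto
        then have "x - (n - d) \<noteq> - c" "x - (n + d) \<noteq> - c" by auto
        then show ?thesis using closed[OF x] by (simp add: mem_flip_True)
      qed
      then show ?C unfolding C_iff by blast
    qed
    then show ?thesis using outer all_outer True by blast
  qed
qed

end

section \<open>Free Motzkin paths and their heights\<close>

definition height :: "step list \<Rightarrow> nat \<Rightarrow> int" where
  "height w i = (\<Sum>p\<leftarrow>take i w. snd (displacement p))"

lemma snd_displacement_eq_iff: "snd (displacement x) = snd (displacement y) \<longleftrightarrow> x = y"
  by (cases x; cases y) simp_all

lemma height_0 [simp]: "height w 0 = 0"
  by (simp add: height_def)

lemma height_Suc: "i < length w \<Longrightarrow> height w (Suc i) = height w i + snd (displacement (w ! i))"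
  by (simp add: height_def take_Suc_conv_app_nth)

lemma height_step: "i < length w \<Longrightarrow> \<bar>height w (Suc i) - height w i\<bar> \<le> 1"
  by (cases "w ! i") (simp_all add: height_Suc)

lemma free_motzkin_path_iff:
  "free_motzkin_path m n w \<longleftrightarrow> int (length w) = m \<and> height w (length w) = n"
proof -
  have "(\<Sum>p\<leftarrow>w. fst (displacement p)) = int (length w)"
  proof (induction w)
    case (Cons p w)
    then show ?case by (cases p) simp_all
  qed simp
  then show ?thesis by (simp add: free_motzkin_path_def height_def)
qed

lemma path_with_heights:
  assumes "q 0 = 0" "\<And>i. i < L \<Longrightarrow> \<bar>q (Suc i) - q i\<bar> \<le> 1"
  shows "\<exists>w. length w = L \<and> (\<forall>i \<le> L. height w i = q i)"
  using assms(2)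
proof (induction L)
  case 0
  then show ?case using assms(1) by simp
next
  case (Suc L)
  then obtain w where w: "length w = L" "\<forall>i \<le> L. height w i = q i" by auto
  have "q (Suc L) - q L \<in> {- 1, 0, 1}" using Suc.prems[of L] by auto
  then obtain x where x: "q (Suc L) - q L = snd (displacement x)"
    using displacement.simps by (metis insertE singletonD snd_conv)
  have "height (w @ [x]) i = q i" if "i \<le> Suc L" for i
  proof (cases "i \<le> L")
    case True
    then show ?thesis using w by (simp add: height_def)
  next
    case False
    then have "i = Suc L" using that by simp
    moreover have "height (w @ [x]) (Suc L) = height w L + snd (displacement x)"
      using w(1) by (simp add: height_def)
    ultimately show ?thesis using w x by simp
  qed
  then show ?case using w(1) by (intro exI[of _ "w @ [x]"]) simp
qed

lemma path_eqI:
  assumes "length w = length w'" "\<And>i. i \<le> length w \<Longrightarrow> height w i = height w' i"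
  shows "w = w'"
proof (rule nth_equalityI[OF assms(1)])
  fix i assume i: "i < length w"
  then have "height w (Suc i) = height w' (Suc i)" "height w i = height w' i" using assms(2) by simp_all
  then have "snd (displacement (w ! i)) = snd (displacement (w' ! i))"
    using i assms(1) by (simp add: height_Suc)
  then show "w ! i = w' ! i" by (simp add: snd_displacement_eq_iff)
qed

lemma no_initial_up:
  assumes "0 < length w"
  shows "prefix [U] w \<longleftrightarrow> \<not> height w 1 \<le> 0"
proof -
  obtain x v where "w = x # v" using assms by (cases w) auto
  then show ?thesis by (cases x) (simp_all add: height_def)
qed

lemma suffix_single_iff_height:
  assumes "length w = Suc k"
  shows "suffix [x] w \<longleftrightarrow> height w (Suc k) - height w k = snd (displacement x)"
proof -
  obtain v y where "w = v @ [y]" using assms by (cases w rule: rev_cases) auto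
  then show ?thesis
    using assms snd_displacement_eq_iff[of y x] by (auto simp: suffix_def height_def)
qed

lemma suffix_pair_iff_height:
  assumes "length w = Suc (Suc k)"
  shows "suffix [x, y] w \<longleftrightarrow> height w (Suc k) - height w k = snd (displacement x) \<and>
    height w (Suc (Suc k)) - height w (Suc k) = snd (displacement y)"
proof -
  obtain v z where w: "w = v @ [z]" using assms by (cases w rule: rev_cases) auto
  then obtain u t where "v = u @ [t]" using assms by (cases v rule: rev_cases) auto
  then show ?thesis
    using w assms snd_displacement_eq_iff[of z y] snd_displacement_eq_iff[of t x]
    by (auto simp: suffix_def height_def)
qed

text \<open>A path is the same as its sequence of heights, that is, a sequence from \<open>0\<close> with steps in
  \<open>{-1, 0, 1}\<close>. The function \<open>q\<close> reads such a sequence off from the objects to be counted.\<close>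

lemma eqpoll_paths_by_heights:
  assumes zero: "\<And>x. x \<in> X \<Longrightarrow> q x 0 = 0"
    and small: "\<And>x i. x \<in> X \<Longrightarrow> i < L \<Longrightarrow> \<bar>q x (Suc i) - q x i\<bar> \<le> 1"
    and into: "\<And>x w. x \<in> X \<Longrightarrow> length w = L \<Longrightarrow> (\<And>i. i \<le> L \<Longrightarrow> height w i = q x i) \<Longrightarrow> w \<in> W"
    and onto: "\<And>w. w \<in> W \<Longrightarrow> length w = L \<and> (\<exists>x \<in> X. \<forall>i \<le> L. height w i = q x i)"
    and inj: "\<And>x y. x \<in> X \<Longrightarrow> y \<in> X \<Longrightarrow> (\<And>i. i \<le> L \<Longrightarrow> q x i = q y i) \<Longrightarrow> x = y"
  shows "X \<approx> W"
proof -
  have "\<forall>x \<in> X. \<exists>w. length w = L \<and> (\<forall>i \<le> L. height w i = q x i)"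
    using path_with_heights zero small by metis
  then obtain g where g: "\<And>x. x \<in> X \<Longrightarrow> length (g x) = L"
      "\<And>x i. x \<in> X \<Longrightarrow> i \<le> L \<Longrightarrow> height (g x) i = q x i"
    by metis
  have "bij_betw g X W"
    unfolding bij_betw_def
  proof (intro conjI subset_antisym subsetI)
    show "inj_on g X" using g inj by (metis inj_onI)
  next
    fix w assume "w \<in> g ` X"
    then show "w \<in> W" using into g by blast
  next
    fix w assume w: "w \<in> W"
    then obtain x where x: "x \<in> X" "\<forall>i \<le> L. height w i = q x i" "length w = L" using onto by blast
    then have "g x = w" using g by (intro path_eqI) auto
    then show "w \<in> g ` X" using x by blast
  qed
  then show ?thesis by (auto simp: eqpoll_def)
qed

section \<open>Profiles as free Motzkin paths\<close>

context lattice_coordinates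
begin

lemma profile_through_path:
  obtains f where "profile f" "\<And>i. 1 \<le> i \<Longrightarrow> 2 * int i < n \<Longrightarrow> f (int i) = height w i"
proof -
  obtain f where "profile f" "\<And>j. 1 \<le> j \<Longrightarrow> 2 * j < n \<Longrightarrow> f j = height w (nat j)"
    using profile_exists[of "\<lambda>j. height w (nat j)"] by blast
  then show thesis using that[of f] by simp
qed

lemma profile_eq_natI:
  assumes "profile f" "profile g" "n \<le> 2 * int M + 2"
    and "\<And>i. 1 \<le> i \<Longrightarrow> i \<le> M \<Longrightarrow> f (int i) = g (int i)"
  shows "f = g"
proof (rule profile_eqI[OF assms(1,2)])
  fix j assume "1 \<le> j" "2 * j < n"
  then show "f j = g j" using assms(3) assms(4)[of "nat j"] by simp
qed

text \<open>The path visits the heights \<open>f 1, \<dots>, f M\<close>, preceded by \<open>0\<close> and followed by the fixed end height. It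
  starts at \<open>0\<close> rather than at \<open>f 0 = - 1\<close>, so that the two values allowed for \<open>f 1\<close> become the steps \<open>D\<close>
  and \<open>F\<close>. Likewise the two values allowed for \<open>f M\<close> become a last step \<open>F\<close> or \<open>U\<close>.\<close>

lemma profiles_eqpoll_even_difference:
  assumes n: "n = 2 * int M + 1" "0 < M"
  shows "{f. profile f \<and> f 1 \<in> {- 1, 0} \<and> (\<forall>j. 1 \<le> j \<and> j < int M \<longrightarrow> step_ok f j) \<and>
      f (int M) \<in> {- e, - e - 1}} \<approx> free_motzkin_paths (int M + 1) (- e) {[U]} {[D]}"
    (is "?X \<approx> ?W")
proof -
  define q where "q f i = (if i = 0 then 0 else if i \<le> M then f (int i) else - e)"
    for f :: "int \<Rightarrow> int" and i
  have W_iff: "w \<in> ?W \<longleftrightarrow> length w = Suc M \<and> height w (Suc M) = - e \<and> height w 1 \<le> 0 \<and>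
      height w (Suc M) - height w M \<noteq> - 1" for w
  proof (cases "length w = Suc M")
    case True
    then have "0 < length w" by simp
    then show ?thesis
      using True no_initial_up[of w] suffix_single_iff_height[OF True, of D]
      by (auto simp: free_motzkin_paths_def free_motzkin_path_iff)
  next
    case False
    then show ?thesis by (auto simp: free_motzkin_paths_def free_motzkin_path_iff)
  qed
  show ?thesis
  proof (rule eqpoll_paths_by_heights[where q = q and L = "Suc M"])
    fix f i assume f: "f \<in> ?X" and i: "i < Suc M"
    consider "i = 0" | "1 \<le> i" "i < M" | "i = M" using i by linarith
    then show "\<bar>q f (Suc i) - q f i\<bar> \<le> 1"
    proof cases
      case 2
      then have "step_ok f (int i)" using f by auto
      then show ?thesis using 2 by (simp add: q_def step_ok_def add.commute)
    qed (use f n in \<open>auto simp: q_def\<close>)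
  next
    fix f w assume f: "f \<in> ?X" and w: "length w = Suc M" "\<And>i. i \<le> Suc M \<Longrightarrow> height w i = q f i"
    show "w \<in> ?W"
      unfolding W_iff using f n w(1) w(2)[of 1] w(2)[of M] w(2)[of "Suc M"] by (auto simp: q_def)
  next
    fix w assume "w \<in> ?W"
    then have w: "length w = Suc M" "height w (Suc M) = - e" "height w 1 \<le> 0"
      "height w (Suc M) - height w M \<noteq> - 1" unfolding W_iff by blast+
    obtain f where profile: "profile f"
      and "\<And>i. 1 \<le> i \<Longrightarrow> 2 * int i < n \<Longrightarrow> f (int i) = height w i"
      by (rule profile_through_path[of w]) blast
    then have "\<And>i. 1 \<le> i \<Longrightarrow> i \<le> M \<Longrightarrow> f (int i) = height w i" using n by simp
    note f = profile this
    have "f 1 \<in> {- 1, 0}" using f(2)[of 1] n w height_step[of 0 w] by auto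
    moreover have "step_ok f j" if "1 \<le> j" "j < int M" for j
      using f(2)[of "nat j"] f(2)[of "Suc (nat j)"] that w(1) height_step[of "nat j" w]
      by (simp add: step_ok_def add.commute)
    moreover have "f (int M) \<in> {- e, - e - 1}"
      using f(2)[of M] n w height_step[of M w] by auto
    ultimately have "f \<in> ?X" using f(1) by blast
    moreover have "\<forall>i \<le> Suc M. height w i = q f i" using f w by (auto simp: q_def le_Suc_eq)
    ultimately show "length w = Suc M \<and> (\<exists>f \<in> ?X. \<forall>i \<le> Suc M. height w i = q f i)"
      using w(1) by blast
  next
    fix f g assume f: "f \<in> ?X" "g \<in> ?X" and eq: "\<And>i. i \<le> Suc M \<Longrightarrow> q f i = q g i"
    show "f = g"
    proof (rule profile_eq_natI[of _ _ M])
      fix i assume "1 \<le> i" "i \<le> M"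
      then show "f (int i) = g (int i)" using eq[of i] by (simp add: q_def)
    qed (use f n in auto)
  qed (simp add: q_def)
qed

text \<open>The bound on \<open>f M\<close> says that a single step leads to the end height \<open>- e\<close>, and the bound on
  \<open>f (M - 1)\<close> that the last two steps are neither \<open>UU\<close> nor \<open>DD\<close>. For \<open>M = 1\<close> the predecessor of \<open>f M\<close>
  on the path is \<open>0\<close> instead of \<open>f 0 = - 1\<close>, but then \<open>e = 1\<close>, and both formulations hold automatically.\<close>

lemma profiles_eqpoll_odd_difference:
  assumes n: "n = 2 * int M + 1" "0 < M" and d: "d = 2 * e - 1" "0 < d" "d < n"
  shows "{f. profile f \<and> f 1 \<in> {- 1, 0} \<and> (\<forall>j. 1 \<le> j \<and> j < int M \<longrightarrow> step_ok f j) \<and>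
      \<bar>f (int M) + e\<bar> \<le> 1 \<and> \<bar>f (int M - 1) + e\<bar> \<le> 1} \<approx>
    free_motzkin_paths (int M + 1) (- e) {[U]} {[U, U], [D, D]}" (is "?X \<approx> ?W")
proof -
  define q where "q f i = (if i = 0 then 0 else if i \<le> M then f (int i) else - e)"
    for f :: "int \<Rightarrow> int" and i
  obtain M' where M': "M = Suc M'" using n by (cases M) auto
  have W_iff: "w \<in> ?W \<longleftrightarrow> length w = Suc M \<and> height w (Suc M) = - e \<and> height w 1 \<le> 0 \<and>
      \<not> (height w M - height w M' = 1 \<and> height w (Suc M) - height w M = 1) \<and>
      \<not> (height w M - height w M' = - 1 \<and> height w (Suc M) - height w M = - 1)" for w
  proof (cases "length w = Suc M")
    case True
    then have "0 < length w" by simp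
    then show ?thesis
      using True no_initial_up[of w] suffix_pair_iff_height[OF True[unfolded M'], of U U]
        suffix_pair_iff_height[OF True[unfolded M'], of D D] M'
      by (auto simp: free_motzkin_paths_def free_motzkin_path_iff)
  next
    case False
    then show ?thesis by (auto simp: free_motzkin_paths_def free_motzkin_path_iff)
  qed
  \<comment> \<open>the shortest paths, where the column before the middle is column \<open>0\<close>\<close>
  have M0: "f (int M') = - 1 \<and> e = 1" if "M' = 0" "profile f" for f
  proof -
    have "f 0 = - 1" using that(2) by (simp add: profile_def)
    then show ?thesis using that(1) n d M' by auto
  qed
  show ?thesis
  proof (rule eqpoll_paths_by_heights[where q = q and L = "Suc M"])
    fix f i assume f: "f \<in> ?X" and i: "i < Suc M"
    consider "i = 0" | "1 \<le> i" "i < M" | "i = M" using i by linarith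
    then show "\<bar>q f (Suc i) - q f i\<bar> \<le> 1"
    proof cases
      case 2
      then have "step_ok f (int i)" using f by auto
      then show ?thesis using 2 by (simp add: q_def step_ok_def add.commute)
    qed (use f n in \<open>auto simp: q_def\<close>)
  next
    fix f w assume f: "f \<in> ?X" and w: "length w = Suc M" "\<And>i. i \<le> Suc M \<Longrightarrow> height w i = q f i"
    have "height w (Suc M) = - e" "height w 1 \<le> 0"
      using f n w(2)[of "Suc M"] w(2)[of 1] by (auto simp: q_def)
    moreover have "height w M' \<noteq> - e - 2 \<and> height w M' \<noteq> - e + 2"
    proof (cases "M' = 0")
      case True
      then show ?thesis using M0[OF True, of f] f by simp
    next
      case False
      then have "height w M' = f (int M - 1)" using w(2)[of M'] M' by (simp add: q_def)
      then show ?thesis using f by auto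
    qed
    ultimately show "w \<in> ?W" unfolding W_iff using w(1) by auto
  next
    fix w assume "w \<in> ?W"
    then have w: "length w = Suc M" "height w (Suc M) = - e" "height w 1 \<le> 0"
      "\<not> (height w M - height w M' = 1 \<and> height w (Suc M) - height w M = 1)"
      "\<not> (height w M - height w M' = - 1 \<and> height w (Suc M) - height w M = - 1)"
      unfolding W_iff by blast+
    obtain f where profile: "profile f"
      and "\<And>i. 1 \<le> i \<Longrightarrow> 2 * int i < n \<Longrightarrow> f (int i) = height w i"
      by (rule profile_through_path[of w]) blast
    then have "\<And>i. 1 \<le> i \<Longrightarrow> i \<le> M \<Longrightarrow> f (int i) = height w i" using n by simp
    note f = profile this
    have "f 1 \<in> {- 1, 0}" using f(2)[of 1] n w height_step[of 0 w] by auto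
    moreover have "step_ok f j" if "1 \<le> j" "j < int M" for j
      using f(2)[of "nat j"] f(2)[of "Suc (nat j)"] that w(1) height_step[of "nat j" w]
      by (simp add: step_ok_def add.commute)
    moreover have "\<bar>f (int M) + e\<bar> \<le> 1"
      using f(2)[of M] n w height_step[of M w] by auto
    moreover have "\<bar>f (int M - 1) + e\<bar> \<le> 1"
    proof (cases "M' = 0")
      case True
      then show ?thesis using M0[OF True f(1)] M' by simp
    next
      case False
      then have "f (int M - 1) = height w M'" using f(2)[of M'] M' by simp
      then show ?thesis using w height_step[of M w] height_step[of M' w] M' by auto
    qed
    ultimately have "f \<in> ?X" using f(1) by blast
    moreover have "\<forall>i \<le> Suc M. height w i = q f i" using f w by (auto simp: q_def le_Suc_eq)
    ultimately show "length w = Suc M \<and> (\<exists>f \<in> ?X. \<forall>i \<le> Suc M. height w i = q f i)"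
      using w(1) by blast
  next
    fix f g assume f: "f \<in> ?X" "g \<in> ?X" and eq: "\<And>i. i \<le> Suc M \<Longrightarrow> q f i = q g i"
    show "f = g"
    proof (rule profile_eq_natI[of _ _ M])
      fix i assume "1 \<le> i" "i \<le> M"
      then show "f (int i) = g (int i)" using eq[of i] by (simp add: q_def)
    qed (use f n in auto)
  qed (simp add: q_def)
qed

text \<open>In the column \<open>M + 1 = n / 2\<close> the path visits the largest height occurring in the signed set: \<open>- e\<close>, or
  \<open>1 - e\<close> if the middle elements have been exchanged. It ends with one more step to \<open>- e\<close>, which is \<open>F\<close> in the
  first case and \<open>D\<close> in the second. In the second case the profile value before the middle column is
  \<open>- e\<close>, so that the step before the last is \<open>U\<close>. For \<open>M = 0\<close> the exchange is impossible, and no path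
  corresponds to it because \<open>e = 1\<close>.\<close>

lemma profiles_eqpoll_even_modulus:
  assumes n: "n = 2 * (int M + 1)" and d: "d = 2 * e - 1" "0 < d" "d < n"
  shows "{(f, b). profile f \<and> f 1 \<in> {- 1, 0} \<and> (\<forall>j. 1 \<le> j \<and> j < int M + 1 \<longrightarrow> step_ok f j) \<and>
      (b \<longrightarrow> f (int M) = - e \<and> f (int M + 2) = - e)} \<approx>
    free_motzkin_paths (int M + 2) (- e) {[U]} {[F, D], [D, D], [U]}" (is "?X \<approx> ?W")
proof -
  define q where "q = (\<lambda>(f :: int \<Rightarrow> int, b) i. if i = 0 then 0 else if i \<le> M then f (int i)
    else if i = Suc M then - e + of_bool b else - e)"
  have W_iff: "w \<in> ?W \<longleftrightarrow> length w = Suc (Suc M) \<and> height w (Suc (Suc M)) = - e \<and> height w 1 \<le> 0 \<and>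
      height w (Suc (Suc M)) - height w (Suc M) \<noteq> 1 \<and>
      (height w (Suc (Suc M)) - height w (Suc M) = - 1 \<longrightarrow>
        height w (Suc M) - height w M \<noteq> 0 \<and> height w (Suc M) - height w M \<noteq> - 1)" for w
  proof (cases "length w = Suc (Suc M)")
    case True
    then have "0 < length w" by simp
    then show ?thesis
      using True no_initial_up[of w] suffix_pair_iff_height[OF True, of F D]
        suffix_pair_iff_height[OF True, of D D] suffix_single_iff_height[OF True, of U]
      by (auto simp: free_motzkin_paths_def free_motzkin_path_iff)
  next
    case False
    then show ?thesis by (auto simp: free_motzkin_paths_def free_motzkin_path_iff)
  qed
  have mid: "f (int M + 1) = - e" if "profile f" for f
  proof -
    have "\<not> n dvd int M + 1" using n by (simp add: zdvd_not_zless)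
    then show ?thesis using profile_reflect[OF that, of "int M + 1"] n d by simp
  qed
  \<comment> \<open>the shortest paths, where the column before the middle is column \<open>0\<close>\<close>
  have M0: "e = 1 \<and> f 0 = - 1 \<and> f 2 = - 2" if "M = 0" "profile f" for f
  proof -
    have f0: "f 0 = - 1" using that(2) by (simp add: profile_def)
    have "n = 2" "e = 1" "d = 1" using that(1) n d by auto
    then show ?thesis using profile_shift[OF that(2), of 0 1] f0 by simp
  qed
  have mirror: "f (int M + 2) = - 2 * e - f (int M)" if "0 < M" "profile f" for f
  proof -
    have "\<not> n dvd int M" using n that(1) by (simp add: zdvd_not_zless)
    then show ?thesis using profile_reflect[OF that(2), of "int M"] n d by (simp add: algebra_simps)
  qed
  show ?thesis
  proof (rule eqpoll_paths_by_heights[where q = q and L = "Suc (Suc M)"])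
    fix x i assume "x \<in> ?X" and i: "i < Suc (Suc M)"
    then obtain f b where x: "x = (f, b)" and f: "profile f" "f 1 \<in> {- 1, 0}"
      "\<And>j. 1 \<le> j \<Longrightarrow> j < int M + 1 \<Longrightarrow> step_ok f j" "b \<Longrightarrow> f (int M) = - e" by blast
    consider "i = 0" "M = 0" | "i = 0" "0 < M" | "1 \<le> i" "i < M" | "i = M" "0 < M" | "i = Suc M"
      using i by linarith
    then show "\<bar>q x (Suc i) - q x i\<bar> \<le> 1"
    proof cases
      case 1
      then show ?thesis using M0[OF _ f(1)] by (simp add: q_def x)
    next
      case 3
      then have "step_ok f (int i)" using f by auto
      then show ?thesis using 3 by (simp add: q_def x step_ok_def add.commute)
    next
      case 4
      then have "step_ok f (int M)" using f(3) by auto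
      then show ?thesis using 4 f(4) mid[OF f(1)] by (auto simp: q_def x step_ok_def)
    qed (use f in \<open>auto simp: q_def x\<close>)
  next
    fix x w assume "x \<in> ?X"
      and w: "length w = Suc (Suc M)" "\<And>i. i \<le> Suc (Suc M) \<Longrightarrow> height w i = q x i"
    then obtain f b where x: "x = (f, b)" and f: "profile f" "f 1 \<in> {- 1, 0}"
      "b \<Longrightarrow> f (int M) = - e" "b \<Longrightarrow> f (int M + 2) = - e" by blast
    have b0: "\<not> b" if "M = 0" using M0[OF that f(1)] f(4) that by auto
    have "height w 1 \<le> 0"
      using w(2)[of 1] f M0[OF _ f(1)] b0 by (cases "M = 0") (auto simp: q_def x)
    moreover have "height w (Suc M) - height w M = 1" if b
    proof -
      have "0 < M" using b0 that by auto
      then show ?thesis using w(2)[of M] w(2)[of "Suc M"] f(3) that by (simp add: q_def x)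
    qed
    moreover have "height w (Suc (Suc M)) = - e" "height w (Suc M) = - e + of_bool b"
      using w(2)[of "Suc (Suc M)"] w(2)[of "Suc M"] by (simp_all add: q_def x)
    ultimately show "w \<in> ?W" unfolding W_iff using w(1) by (cases b) auto
  next
    fix w assume "w \<in> ?W"
    then have w: "length w = Suc (Suc M)" "height w (Suc (Suc M)) = - e" "height w 1 \<le> 0"
      "height w (Suc (Suc M)) - height w (Suc M) \<noteq> 1"
      "height w (Suc (Suc M)) - height w (Suc M) = - 1 \<Longrightarrow>
        height w (Suc M) - height w M \<noteq> 0 \<and> height w (Suc M) - height w M \<noteq> - 1"
      unfolding W_iff by blast+
    \<comment> \<open>the height above the middle column tells whether the exchange takes place\<close>
    define b where "b \<longleftrightarrow> height w (Suc M) = - e + 1"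
    obtain f where profile: "profile f"
      and "\<And>i. 1 \<le> i \<Longrightarrow> 2 * int i < n \<Longrightarrow> f (int i) = height w i"
      by (rule profile_through_path[of w]) blast
    then have "\<And>i. 1 \<le> i \<Longrightarrow> i \<le> M \<Longrightarrow> f (int i) = height w i" using n by simp
    note f = profile this
    have top: "height w (Suc M) = - e + of_bool b"
      using w height_step[of "Suc M" w] by (auto simp: b_def)
    have below_top: "height w M = - e" if b
      using that w height_step[of M w] by (auto simp: b_def)
    have "f 1 \<in> {- 1, 0}"
    proof (cases "M = 0")
      case True
      then show ?thesis using mid[OF f(1)] M0[OF _ f(1)] by simp
    next
      case False
      then show ?thesis using f(2)[of 1] w height_step[of 0 w] by auto
    qed
    moreover have "step_ok f j" if j: "1 \<le> j" "j < int M + 1" for j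
    proof (cases "j = int M")
      case True
      then have "f j = height w M" using f(2)[of M] j by simp
      then show ?thesis
        using True mid[OF f(1)] top below_top height_step[of M w] w(1)
        by (cases b) (auto simp: step_ok_def)
    next
      case False
      then show ?thesis
        using f(2)[of "nat j"] f(2)[of "Suc (nat j)"] j w(1) height_step[of "nat j" w]
        by (simp add: step_ok_def add.commute)
    qed
    moreover have "f (int M) = - e \<and> f (int M + 2) = - e" if b
    proof -
      have "0 < M" using below_top[OF that] M0[OF _ f(1)] by (cases M) auto
      then show ?thesis using below_top[OF that] f(2)[of M] mirror[OF _ f(1)] by simp
    qed
    ultimately have "(f, b) \<in> ?X" using f(1) by blast
    moreover have "\<forall>i \<le> Suc (Suc M). height w i = q (f, b) i"
      using f w top by (auto simp: q_def le_Suc_eq)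
    ultimately show "length w = Suc (Suc M) \<and> (\<exists>x \<in> ?X. \<forall>i \<le> Suc (Suc M). height w i = q x i)"
      using w(1) by blast
  next
    fix x y assume "x \<in> ?X" "y \<in> ?X" and eq: "\<And>i. i \<le> Suc (Suc M) \<Longrightarrow> q x i = q y i"
    then obtain f b g b' where xy: "x = (f, b)" "y = (g, b')" "profile f" "profile g" by blast
    have "f = g"
    proof (rule profile_eq_natI[of _ _ M])
      fix i assume "1 \<le> i" "i \<le> M"
      then show "f (int i) = g (int i)" using eq[of i] by (simp add: q_def xy)
    qed (use xy n in auto)
    moreover have "b = b'" using eq[of "Suc M"] by (simp add: q_def xy of_bool_eq_iff)
    ultimately show "x = y" using xy by simp
  qed (auto simp: q_def)
qed

end

section \<open>The bijections\<close>

theorem theorem4p14: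
  fixes s d :: nat
  assumes "0 < s" and "0 < d" and "coprime s d"
  shows "(odd s \<and> even d \<longrightarrow>
           (\<exists>f. bij_betw f (CS s (s + d) (s + 2 * d))
              (free_motzkin_paths ((int s + int d + 1) div 2) (- (int d div 2))
                 {[U]} {[D]}))) \<and>
         (odd s \<and> odd d \<longrightarrow>
           (\<exists>f. bij_betw f (CS s (s + d) (s + 2 * d))
              (free_motzkin_paths ((int s + int d + 2) div 2) (- ((int d + 1) div 2))
                 {[U]} {[F, D], [D, D], [U]}))) \<and>
         (even s \<and> odd d \<longrightarrow>
           (\<exists>f. bij_betw f (CS s (s + d) (s + 2 * d))
              (free_motzkin_paths ((int s + int d + 1) div 2) (- ((int d + 1) div 2))
                 {[U]} {[U, U], [D, D]})))"
proof -
  define n where "n = int s + int d"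
  interpret lattice_coordinates n "int d"
  proof
    show "0 < n" using assms by (simp add: n_def)
    have "coprime (int (s + d)) (int d)"
      using assms(3) unfolding coprime_int_iff by (simp add: coprime_iff_gcd_eq_1)
    then show "coprime n (int d)" by (simp add: n_def)
  qed
  have d: "0 < int d" "int d < n" using assms by (simp_all add: n_def)
  let ?B = "{B. balanced B \<and> bar_closed n B}"
  let ?closed = "\<lambda>B. bar_closed (n - int d) B \<and> bar_closed (n + int d) B"
  have CS: "CS s (s + d) (s + 2 * d) \<approx> {B \<in> ?B. ?closed B}"
  proof -
    have eqs: "int s = n - int d" "int (s + d) = n" "int (s + 2 * d) = n + int d"
      by (simp_all add: n_def)
    have "{B \<in> ?B. ?closed B} = {B. balanced B \<and> bar_closed (int s) B \<and>
        bar_closed (int (s + d)) B \<and> bar_closed (int (s + 2 * d)) B}"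
      unfolding eqs by blast
    then show ?thesis
      using bij_betw_CS[of s "s + d" "s + 2 * d"] assms by (auto simp: eqpoll_def)
  qed
  have odd_case: "CS s (s + d) (s + 2 * d) \<approx> {f. profile f \<and> ?closed (below f)}" if "odd n"
  proof -
    \<comment> \<open>an odd modulus has no exceptional element\<close>
    have ne: "2 * x \<noteq> n" "2 * x \<noteq> 3 * n" for x using that by presburger+
    have "?B = {B. balanced B \<and> (\<forall>x \<in> B. x - n \<in> B)}" using ne by (auto simp: bar_closed_def)
    then have "bij_betw below {f \<in> {f. profile f}. ?closed (below f)} {B \<in> ?B. ?closed B}"
      using bij_betw_below by (intro bij_betw_Collect) auto
    then have "{f. profile f \<and> ?closed (below f)} \<approx> {B \<in> ?B. ?closed B}" by (auto simp: eqpoll_def)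
    then show ?thesis using eqpoll_trans[OF CS] eqpoll_sym by blast
  qed
  show ?thesis
  proof (intro conjI impI)
    assume par: "odd s \<and> even d"
    define M where "M = (s + d - 1) div 2"
    have nM: "n = 2 * int M + 1" "0 < M" using par assms by (auto simp: n_def M_def elim!: oddE evenE)
    have "CS s (s + d) (s + 2 * d) \<approx> {f. profile f \<and> ?closed (below f)}"
      by (rule odd_case) (use nM in simp)
    also have "{f. profile f \<and> ?closed (below f)} = {f. profile f \<and> f 1 \<in> {- 1, 0} \<and>
        (\<forall>j. 1 \<le> j \<and> j < int M \<longrightarrow> step_ok f j) \<and> f (int M) \<in> {- (int d div 2), - (int d div 2) - 1}}"
      using bar_closed_iff_even_difference[of _ "int M"] nM par by auto
    also have "\<dots> \<approx> free_motzkin_paths (int M + 1) (- (int d div 2)) {[U]} {[D]}"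
      by (rule profiles_eqpoll_even_difference[OF nM])
    finally have "CS s (s + d) (s + 2 * d) \<approx> free_motzkin_paths (int M + 1) (- (int d div 2)) {[U]} {[D]}" .
    moreover have "(int s + int d + 1) div 2 = int M + 1" using nM by (simp add: n_def)
    ultimately show "\<exists>f. bij_betw f (CS s (s + d) (s + 2 * d))
        (free_motzkin_paths ((int s + int d + 1) div 2) (- (int d div 2)) {[U]} {[D]})"
      by (simp only: eqpoll_def)
  next
    assume par: "odd s \<and> odd d"
    define M where "M = (s + d) div 2 - 1"
    define e where "e = (int d + 1) div 2"
    have nM: "n = 2 * (int M + 1)" and de: "int d = 2 * e - 1"
      using par assms by (auto simp: n_def M_def e_def elim!: oddE)
    have neighbours: "int M + 1 - 1 = int M" "int M + 1 + 1 = int M + 2" by simp_all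
    \<comment> \<open>the second component tells whether \<open>n / 2\<close> is a part\<close>
    let ?X = "{(f, b). profile f \<and> ?closed (flip (int M + 1) b (below f))}"
    have "bij_betw below {f. profile f} {B. balanced B \<and> (\<forall>x \<in> B. x - 2 * (int M + 1) \<in> B)}"
      using bij_betw_below nM by simp
    then have "bij_betw (map_prod below id) ({f. profile f} \<times> UNIV)
        ({B. balanced B \<and> (\<forall>x \<in> B. x - 2 * (int M + 1) \<in> B)} \<times> (UNIV :: bool set))"
      by (rule bij_betw_map_prod[OF _ bij_betw_id])
    then have "bij_betw ((\<lambda>(B, b). flip (int M + 1) b B) \<circ> map_prod below id)
        ({f. profile f} \<times> UNIV) ?B"
      using bij_betw_flip[of "int M + 1"] nM by (intro bij_betw_trans) auto
    then have "bij_betw ((\<lambda>(B, b). flip (int M + 1) b B) \<circ> map_prod below id)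
        {x \<in> {f. profile f} \<times> UNIV. case x of (f, b) \<Rightarrow> ?closed (flip (int M + 1) b (below f))}
        {B \<in> ?B. ?closed B}"
      by (rule bij_betw_Collect) auto
    moreover have "{x \<in> {f. profile f} \<times> UNIV. case x of (f, b) \<Rightarrow>
        ?closed (flip (int M + 1) b (below f))} = ?X" by auto
    ultimately have "?X \<approx> {B \<in> ?B. ?closed B}" unfolding eqpoll_def by metis
    then have "CS s (s + d) (s + 2 * d) \<approx> ?X" using eqpoll_trans[OF CS] eqpoll_sym by blast
    also have "?X = {(f, b). profile f \<and> f 1 \<in> {- 1, 0} \<and>
        (\<forall>j. 1 \<le> j \<and> j < int M + 1 \<longrightarrow> step_ok f j) \<and>
        (b \<longrightarrow> f (int M) = - e \<and> f (int M + 2) = - e)}"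
      using bar_closed_flip_iff[OF _ nM de d, unfolded neighbours] by blast
    also have "\<dots> \<approx> free_motzkin_paths (int M + 2) (- e) {[U]} {[F, D], [D, D], [U]}"
      by (rule profiles_eqpoll_even_modulus[OF nM de d])
    finally have "CS s (s + d) (s + 2 * d) \<approx>
        free_motzkin_paths (int M + 2) (- e) {[U]} {[F, D], [D, D], [U]}" .
    moreover have "(int s + int d + 2) div 2 = int M + 2" using nM by (simp add: n_def)
    ultimately show "\<exists>f. bij_betw f (CS s (s + d) (s + 2 * d))
        (free_motzkin_paths ((int s + int d + 2) div 2) (- ((int d + 1) div 2))
          {[U]} {[F, D], [D, D], [U]})"
      by (simp only: eqpoll_def e_def)
  next
    assume par: "even s \<and> odd d"
    define M where "M = (s + d - 1) div 2"
    define e where "e = (int d + 1) div 2"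
    have nM: "n = 2 * int M + 1" "0 < M" and de: "int d = 2 * e - 1"
      using par assms by (auto simp: n_def M_def e_def elim!: oddE evenE)
    have "CS s (s + d) (s + 2 * d) \<approx> {f. profile f \<and> ?closed (below f)}"
      by (rule odd_case) (use nM in simp)
    also have "{f. profile f \<and> ?closed (below f)} = {f. profile f \<and> f 1 \<in> {- 1, 0} \<and>
        (\<forall>j. 1 \<le> j \<and> j < int M \<longrightarrow> step_ok f j) \<and> \<bar>f (int M) + e\<bar> \<le> 1 \<and> \<bar>f (int M - 1) + e\<bar> \<le> 1}"
      using bar_closed_iff_odd_difference[OF _ nM(1) _ de d] nM(2) by auto
    also have "\<dots> \<approx> free_motzkin_paths (int M + 1) (- e) {[U]} {[U, U], [D, D]}"
      by (rule profiles_eqpoll_odd_difference[OF nM de d])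
    finally have "CS s (s + d) (s + 2 * d) \<approx> free_motzkin_paths (int M + 1) (- e) {[U]} {[U, U], [D, D]}" .
    moreover have "(int s + int d + 1) div 2 = int M + 1" using nM by (simp add: n_def)
    ultimately show "\<exists>f. bij_betw f (CS s (s + d) (s + 2 * d))
        (free_motzkin_paths ((int s + int d + 1) div 2) (- ((int d + 1) div 2)) {[U]} {[U, U], [D, D]})"
      by (simp only: eqpoll_def e_def)
  qed
qed

end
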